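(* Let $G$ be a connected graph of order $n$. Then $$h_p(G)\le \bigg\lfloor\frac{n-\Delta'(G)-d_{\ge3}^{**}(G)}{3}\bigg\rfloor+3.$$
   Context: Graphs are finite, undirected and loopless (multiple edges are allowed). The line graph $L(G)$ has vertex set $E(G)$, two vertices being adjacent if and only if the corresponding edges of $G$ share an endpoint; $L^0(G)=G$, $L^1(G)=L(G)$, $L^m(G)=L(L^{m-1}(G))$ (with $L^{m-1}(G)$ assumed to have a nonempty edge set). A graph is traceable if it has a hamiltonian path. The hamiltonian path index $h_p(G)$ is the minimum integer $m\ge 0$ such that $L^m(G)$ is traceable (so $h_p(G)=0$ if $G$ is traceable). $V_i(G)$ is the set of vertices of degree $i$ in $G$ (degree counts edges with multiplicity), $\Delta(G)$ is the maximum degree, and $N_G(v)$ is the set of neighbours of $v$. Put $d'_G(v)=|N_G(v)|$, $\Delta'(G)=\max\{d'_G(v): v\in V(G)\}$, and $$d_{\ge3}^{**}(G)=\max\Big\{\Big|\Big(\bigcup_{i=3}^{\Delta(G)}V_i(G)\Big)\setminus N_G(v)\Big| : v\in V(G),\ |N_G(v)|=\Delta'(G)\Big\}.$$ *)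

theory Defs
  imports Complex_Main "HOL-Library.Countable_Set"
begin

record ('v, 'e) mgraph =
  verts :: "'v set"
  edges :: "'e set"
  ends :: "'e \<Rightarrow> 'v set"

text \<open>Finite, undirected, loopless graphs; distinct edges may have the same set of endpoints.\<close>

definition multigraph :: "('v, 'e) mgraph \<Rightarrow> bool" where
  "multigraph G \<longleftrightarrow> finite (verts G) \<and> finite (edges G) \<and>
     (\<forall>e\<in>edges G. ends G e \<subseteq> verts G \<and> card (ends G e) = 2)"

definition adjacent :: "('v, 'e) mgraph \<Rightarrow> 'v \<Rightarrow> 'v \<Rightarrow> bool" where
  "adjacent G u v \<longleftrightarrow> (\<exists>e\<in>edges G. ends G e = {u, v})"

definition connected_mgraph :: "('v, 'e) mgraph \<Rightarrow> bool" where
  "connected_mgraph G \<longleftrightarrow> verts G \<noteq> {} \<and>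
     (\<forall>u\<in>verts G. \<forall>v\<in>verts G. (adjacent G)\<^sup>*\<^sup>* u v)"

definition hamiltonian_path :: "('v, 'e) mgraph \<Rightarrow> 'v list \<Rightarrow> bool" where
  "hamiltonian_path G p \<longleftrightarrow>
     p \<noteq> [] \<and> distinct p \<and> set p = verts G \<and> successively (adjacent G) p"

definition traceable :: "('v, 'e) mgraph \<Rightarrow> bool" where
  "traceable G \<longleftrightarrow> (\<exists>p. hamiltonian_path G p)"

text \<open>The line graph is simple: each of its edges is identified with its set of endpoints.\<close>

definition line_graph :: "('v, 'e) mgraph \<Rightarrow> ('e, 'e set) mgraph" where
  "line_graph G =
     \<lparr>verts = edges G,
      edges = {{e, f} |e f. e \<in> edges G \<and> f \<in> edges G \<and> e \<noteq> f \<and> ends G e \<inter> ends G f \<noteq> {}},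
      ends = (\<lambda>s. s)\<rparr>"

text \<open>
  Every application of the line graph operator changes the types of vertices and edges. In order to
  iterate it, each graph is replaced by an isomorphic copy with natural numbers as
  vertices and edges. For a finite graph the two relabelling functions below are injective.
\<close>

definition relabel ::
  "('v \<Rightarrow> 'w) \<Rightarrow> ('e \<Rightarrow> 'f) \<Rightarrow> ('v, 'e) mgraph \<Rightarrow> ('w, 'f) mgraph" where
  "relabel f g G =
     \<lparr>verts = f ` verts G,
      edges = g ` edges G,
      ends = (\<lambda>x. f ` ends G (inv_into (edges G) g x))\<rparr>"

definition nat_copy :: "('v, 'e) mgraph \<Rightarrow> (nat, nat) mgraph" where
  "nat_copy G = relabel (to_nat_on (verts G)) (to_nat_on (edges G)) G"

lemma nat_copy_iso:
  assumes "multigraph G"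
  shows "bij_betw (to_nat_on (verts G)) (verts G) (verts (nat_copy G))"
    and "bij_betw (to_nat_on (edges G)) (edges G) (edges (nat_copy G))"
    and "\<And>e. e \<in> edges G \<Longrightarrow>
      ends (nat_copy G) (to_nat_on (edges G) e) = to_nat_on (verts G) ` ends G e"
  using assms
  by (auto simp: multigraph_def nat_copy_def relabel_def bij_betw_def countable_finite
      inj_on_to_nat_on)

primrec iterated_line_graph :: "nat \<Rightarrow> ('v, 'e) mgraph \<Rightarrow> (nat, nat) mgraph" where
  "iterated_line_graph 0 G = nat_copy G"
| "iterated_line_graph (Suc m) G = nat_copy (line_graph (iterated_line_graph m G))"

text \<open>
  If the \<open>m\<close>-th iterated line graph has no edges, the next one has no vertices and
  is therefore not traceable, since a hamiltonian path is nonempty. So only those \<open>m\<close> count for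
  which all earlier iterates have an edge. The value is meaningful only if some iterate is traceable.
\<close>

definition hamiltonian_path_index :: "('v, 'e) mgraph \<Rightarrow> nat" where
  "hamiltonian_path_index G = (LEAST m. traceable (iterated_line_graph m G))"

definition degree :: "('v, 'e) mgraph \<Rightarrow> 'v \<Rightarrow> nat" where
  "degree G v = card {e \<in> edges G. v \<in> ends G e}"

definition verts_of_degree :: "('v, 'e) mgraph \<Rightarrow> nat \<Rightarrow> 'v set" where
  "verts_of_degree G i = {v \<in> verts G. degree G v = i}"

definition max_degree :: "('v, 'e) mgraph \<Rightarrow> nat" where
  "max_degree G = Max (degree G ` verts G)"

definition nbrs :: "('v, 'e) mgraph \<Rightarrow> 'v \<Rightarrow> 'v set" where
  "nbrs G v = {u \<in> verts G. adjacent G v u}"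

definition max_nbrs :: "('v, 'e) mgraph \<Rightarrow> nat" where
  "max_nbrs G = Max ((\<lambda>v. card (nbrs G v)) ` verts G)"

definition d_ge3 :: "('v, 'e) mgraph \<Rightarrow> nat" where
  "d_ge3 G = Max {card ((\<Union>i\<in>{3..max_degree G}. verts_of_degree G i) - nbrs G v) |v.
                    v \<in> verts G \<and> card (nbrs G v) = max_nbrs G}"

end

(*
  Call a vertex big if its degree is at least 3 and small otherwise. One line graph step shortens
  each component of the graph induced by the small vertices by one vertex. Let k be the number of
  small vertices outside N(v), where v attains the maximum in the definition of d_ge3, and let
  t = k div 3 + 1. As N(v) meets a component in at most two vertices, and in at most one if the
  component joins different parts of the graph, fewer than 3t vertices cannot accommodate three
  components that survive t steps in an essential way. So in B, the t-th iterate, at most two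
  essential components remain.

  In L(B), the edges at a big vertex form a clique of size at least 3, with hamiltonian paths between
  any two vertices and a hamiltonian cycle. Splicing these along a connected set M of big vertices
  gives, for any two edges a, b incident with M, a trail from a to b through all edges incident
  with M. The two essential components are traversed as paths before and after such a trail, and
  closed trails of the remaining connected sets of big vertices are spliced in. The resulting trail
  dominates L(B), so L(L(B)) is traceable. If at some stage there is no big vertex, that iterate is
  itself traceable.
*)

theory Submission
  imports Defs "HOL-Library.Multiset"
begin

section \<open>Paths and trails\<close>

definition conn_in :: "'a set \<Rightarrow> ('a \<Rightarrow> 'a \<Rightarrow> bool) \<Rightarrow> 'a \<Rightarrow> 'a \<Rightarrow> bool" where
  "conn_in X R = (\<lambda>a b. a \<in> X \<and> b \<in> X \<and> R a b)\<^sup>*\<^sup>*"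

lemma conn_in_leaves:
  assumes "conn_in X R x y" "x \<in> A" "y \<notin> A"
  obtains u v where "u \<in> A" "v \<notin> A" "u \<in> X" "v \<in> X" "R u v"
  using assms unfolding conn_in_def by (induction rule: rtranclp_induct) blast+

lemma conn_in_refl [simp]: "conn_in X R x x"
  by (simp add: conn_in_def)

lemma conn_in_trans: "conn_in X R x y \<Longrightarrow> conn_in X R y z \<Longrightarrow> conn_in X R x z"
  unfolding conn_in_def by (rule rtranclp_trans)

lemma conn_in_step: "x \<in> X \<Longrightarrow> y \<in> X \<Longrightarrow> R x y \<Longrightarrow> conn_in X R x y"
  by (auto simp: conn_in_def)

lemma conn_in_sym:
  assumes "symp R" "conn_in X R x y"
  shows "conn_in X R y x"
proof -
  have "symp (\<lambda>a b. a \<in> X \<and> b \<in> X \<and> R a b)"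
    using assms(1) by (auto simp: symp_def)
  then show ?thesis
    using assms(2) unfolding conn_in_def by (meson sympD symp_rtranclp)
qed

lemma conn_in_mem: "conn_in X R x y \<Longrightarrow> x \<in> X \<Longrightarrow> y \<in> X"
  unfolding conn_in_def by (induction rule: rtranclp_induct) auto

lemma conn_in_mono: "conn_in X R x y \<Longrightarrow> X \<subseteq> Y \<Longrightarrow> conn_in Y R x y"
  unfolding conn_in_def by (erule rtranclp_mono[THEN predicate2D, rotated]) auto

lemma conn_in_induct [consumes 1, case_names refl step]:
  assumes "conn_in X R x y" "P x"
    "\<And>y z. conn_in X R x y \<Longrightarrow> y \<in> X \<Longrightarrow> z \<in> X \<Longrightarrow> R y z \<Longrightarrow> P y \<Longrightarrow> P z"
  shows "P y"
  using assms(1) unfolding conn_in_def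
  by (induction rule: rtranclp_induct) (use assms(2,3) in \<open>auto simp: conn_in_def\<close>)

definition component :: "'a set \<Rightarrow> ('a \<Rightarrow> 'a \<Rightarrow> bool) \<Rightarrow> 'a \<Rightarrow> 'a set" where
  "component X R d = {x. conn_in X R d x}"

lemma component_refl [simp]: "d \<in> component X R d"
  by (simp add: component_def)

lemma component_eq: "symp R \<Longrightarrow> x \<in> component X R d \<Longrightarrow> component X R x = component X R d"
  using conn_in_sym conn_in_trans unfolding component_def by fast

lemma component_subset: "d \<in> X \<Longrightarrow> component X R d \<subseteq> X"
  by (auto simp: component_def dest: conn_in_mem)

lemma component_step:
  "d \<in> X \<Longrightarrow> x \<in> component X R d \<Longrightarrow> R x y \<Longrightarrow> y \<in> X \<Longrightarrow> y \<in> component X R d"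
  using conn_in_trans[OF _ conn_in_step] component_subset unfolding component_def
  by (metis mem_Collect_eq subsetD)

lemma component_adj: "x \<in> X \<Longrightarrow> R x y \<Longrightarrow> y \<in> X \<Longrightarrow> y \<in> component X R x"
  by (simp add: component_def conn_in_step)

lemma component_disjoint:
  "symp R \<Longrightarrow> y \<notin> component X R x \<Longrightarrow> component X R x \<inter> component X R y = {}"
  by (metis component_eq component_refl disjoint_iff)

lemma component_conn:
  assumes "symp R" "d \<in> X" "x \<in> component X R d" "y \<in> component X R d"
  shows "conn_in (component X R d) R x y"
proof -
  have "conn_in (component X R d) R d z" if "conn_in X R d z" for z
    using that
  proof (induction rule: conn_in_induct)
    case (step y z)
    then have "y \<in> component X R d" "z \<in> component X R d"
      using component_step[OF assms(2)] by (auto simp: component_def)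
    then have "conn_in (component X R d) R y z"
      using step by (intro conn_in_step)
    then show ?case
      using step by (intro conn_in_trans[of _ _ d y z])
  qed simp
  then have "conn_in (component X R d) R d x" "conn_in (component X R d) R d y"
    using assms by (auto simp: component_def)
  then show ?thesis
    using conn_in_trans[OF conn_in_sym[OF assms(1), where x = d and y = x]] by blast
qed

lemma card_ge3I:
  assumes "finite A" "{a, b, c} \<subseteq> A" "a \<noteq> b" "a \<noteq> c" "b \<noteq> c"
  shows "3 \<le> card A"
proof -
  have "card {a, b, c} = 3"
    using assms by simp
  then show ?thesis
    using card_mono[OF assms(1,2)] by simp
qed

lemma successively_if_all: "(\<And>a b. a \<in> set w \<Longrightarrow> b \<in> set w \<Longrightarrow> P a b) \<Longrightarrow> successively P w"
  by (induction w rule: induct_list012) auto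

lemma successively_if_distinct:
  "distinct w \<Longrightarrow> successively P w \<Longrightarrow> successively (\<lambda>a b. a \<noteq> b \<and> P a b) w"
  by (induction w rule: induct_list012) auto

text \<open>A longest path does it. An inner vertex has its two neighbours on the path already; if a
  vertex were missed, connectivity would give an edge leaving the path, necessarily at an end, and
  the path could grow. Likewise a vertex with at most one neighbour cannot be inner.\<close>

lemma spanning_path_if_degree_le_2:
  assumes fin: "finite X" and ne: "X \<noteq> {}" and sym: "symp R" and irr: "\<And>x. \<not> R x x"
    and conn: "\<And>x y. x \<in> X \<Longrightarrow> y \<in> X \<Longrightarrow> conn_in X R x y"
    and deg: "\<And>x. x \<in> X \<Longrightarrow> card {y \<in> X. R x y} \<le> 2"
  obtains w where "distinct w" "set w = X" "w \<noteq> []" "successively R w"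
    "\<And>x. x \<in> X \<Longrightarrow> card {y \<in> X. R x y} \<le> 1 \<Longrightarrow> x = hd w \<or> x = last w"
proof -
  have symR: "R x y \<longleftrightarrow> R y x" for x y
    using sym by (blast dest: sympD)
  define P where "P w \<longleftrightarrow> distinct w \<and> w \<noteq> [] \<and> set w \<subseteq> X \<and> successively R w" for w
  obtain x0 where "x0 \<in> X"
    using ne by blast
  then have "P [x0]"
    by (simp add: P_def)
  moreover have "length w \<le> card X" if "P w" for w
    using fin that by (metis P_def card_mono distinct_card)
  ultimately have "\<exists>w. P w \<and> (\<forall>w'. P w' \<longrightarrow> length w' \<le> length w)"
    by (intro ex_has_greatest_nat[where b = "Suc (card X)"]) (auto simp: less_Suc_eq_le)
  then obtain w where w: "P w" and mx: "\<And>w'. P w' \<Longrightarrow> length w' \<le> length w"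
    by blast
  have inner: "\<exists>a b. a \<noteq> b \<and> a \<in> set w \<and> b \<in> set w \<and> R u a \<and> R u b"
    if u: "u \<in> set w" "u \<noteq> hd w" "u \<noteq> last w" for u
  proof -
    obtain p q where pq: "w = p @ u # q"
      using u(1) by (meson split_list)
    have "p \<noteq> []" "q \<noteq> []"
      using u pq by auto
    then obtain p' a b q' where "p = p' @ [a]" "q = b # q'"
      by (meson neq_Nil_conv rev_exhaust)
    then have "w = p' @ a # u # b # q'"
      using pq by simp
    then show ?thesis
      using w symR[of a u] by (intro exI[of _ a] exI[of _ b]) (auto simp: P_def successively_append_iff)
  qed
  have "set w = X"
  proof (rule ccontr)
    assume "set w \<noteq> X"
    then obtain y where y: "y \<in> X" "y \<notin> set w"
      using w by (auto simp: P_def)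
    have hd: "hd w \<in> set w"
      using w by (simp add: P_def)
    then have "conn_in X R (hd w) y"
      using conn y w by (auto simp: P_def subset_iff)
    then obtain u v where uv: "u \<in> set w" "v \<notin> set w" "u \<in> X" "v \<in> X" "R u v"
      using conn_in_leaves[OF _ hd y(2)] by blast
    consider "u = hd w" | "u = last w" | "u \<noteq> hd w" "u \<noteq> last w"
      by blast
    then show False
    proof cases
      case 1
      then have "P (v # w)"
        using w uv symR[of u v] by (auto simp: P_def successively_Cons)
      then show False
        using mx by fastforce
    next
      case 2
      then have "P (w @ [v])"
        using w uv by (auto simp: P_def successively_append_iff)
      then show False
        using mx by fastforce
    next
      case 3
      then obtain a b where "a \<noteq> b" "a \<in> set w" "b \<in> set w" "R u a" "R u b"
        using inner uv by blast
      then have "3 \<le> card {y \<in> X. R u y}"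
        using uv w fin by (intro card_ge3I[of _ a b v]) (auto simp: P_def)
      then show False
        using deg[OF uv(3)] by simp
    qed
  qed
  moreover have "x = hd w \<or> x = last w" if x: "x \<in> X" "card {y \<in> X. R x y} \<le> 1" for x
  proof (rule ccontr)
    assume "\<not> ?thesis"
    then obtain a b where ab: "a \<noteq> b" "a \<in> X" "b \<in> X" "R x a" "R x b"
      using inner x \<open>set w = X\<close> by blast
    then have "card {a, b} \<le> card {y \<in> X. R x y}"
      using fin by (intro card_mono) auto
    then show False
      using x ab by simp
  qed
  ultimately show thesis
    using w that by (auto simp: P_def)
qed

text \<open>
  A trail that may list an edge at its current vertex without traversing it. Its list of edges is a
  path in the line graph as soon as it is distinct; the set argument collects the visited vertices.
\<close>

inductive dtrail :: "('c \<Rightarrow> 'a set) \<Rightarrow> 'a \<Rightarrow> 'c list \<Rightarrow> 'a set \<Rightarrow> 'a \<Rightarrow> bool"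
  for en :: "'c \<Rightarrow> 'a set" where
  nil: "dtrail en a [] {a} a"
| move: "en c = {a, b} \<Longrightarrow> dtrail en b p U z \<Longrightarrow> dtrail en a (c # p) (insert a U) z"
| stay: "a \<in> en c \<Longrightarrow> dtrail en a p U z \<Longrightarrow> dtrail en a (c # p) U z"

lemma dtrail_start: "dtrail en a p U b \<Longrightarrow> a \<in> U"
  by (induction rule: dtrail.induct) auto

lemma dtrail_append:
  "dtrail en a p U b \<Longrightarrow> dtrail en b q W c \<Longrightarrow> dtrail en a (p @ q) (U \<union> W) c"
proof (induction rule: dtrail.induct)
  case (nil a)
  then show ?case
    using dtrail_start[OF nil] by (simp add: insert_absorb)
next
  case (move c a b p U z)
  then show ?case
    by (simp add: dtrail.move)
next
  case (stay a c p U z)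
  then show ?case
    by (simp add: dtrail.stay)
qed

lemma dtrail_split:
  assumes "dtrail en a p U b" "x \<in> U"
  obtains p1 p2 U1 U2 where "p = p1 @ p2" "U = U1 \<union> U2" "dtrail en a p1 U1 x" "dtrail en x p2 U2 b"
  using assms
proof (induction arbitrary: thesis rule: dtrail.induct)
  case (nil a)
  then show ?case
    using nil(1)[of "[]" "[]" "{a}" "{a}"] by (simp add: dtrail.nil)
next
  case (move c a b p U z)
  show ?case
  proof (cases "x = a")
    case True
    then show ?thesis
      using move.prems(1)[of "[]" "c # p" "{a}" "insert a U"] dtrail.move[OF move.hyps(1,2)]
      by (simp add: dtrail.nil)
  next
    case False
    then obtain p1 p2 U1 U2 where "p = p1 @ p2" "U = U1 \<union> U2" "dtrail en b p1 U1 x" "dtrail en x p2 U2 z"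
      using move.IH move.prems by blast
    then show ?thesis
      using move.prems(1)[of "c # p1" p2 "insert a U1" U2] move.hyps by (simp add: dtrail.move)
  qed
next
  case (stay a c p U z)
  then obtain p1 p2 U1 U2 where "p = p1 @ p2" "U = U1 \<union> U2" "dtrail en a p1 U1 x" "dtrail en x p2 U2 z"
    by blast
  then show ?case
    using stay.prems(1)[of "c # p1" p2 U1 U2] stay.hyps by (simp add: dtrail.stay)
qed

text \<open>The trail is cut at a visit of \<open>x\<close> and the closed trail is inserted there.
  Recording the multiset of listed edges is enough to transfer distinctness.\<close>

lemma dtrail_splice:
  assumes "dtrail en a p U b" "x \<in> U" "dtrail en x q W x"
  obtains r where "dtrail en a r (U \<union> W) b" "mset r = mset p + mset q"
proof -
  obtain p1 p2 U1 U2 where *: "p = p1 @ p2" "U = U1 \<union> U2" "dtrail en a p1 U1 x" "dtrail en x p2 U2 b"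
    using dtrail_split[OF assms(1,2)] .
  have "dtrail en a (p1 @ q @ p2) (U1 \<union> (W \<union> U2)) b"
    using * assms(3) by (blast intro: dtrail_append)
  moreover have "U1 \<union> (W \<union> U2) = U \<union> W"
    using * by blast
  ultimately show thesis
    using that[of "p1 @ q @ p2"] * by simp
qed

text \<open>The second conjunct carries the induction: the next listed edge contains the current
  vertex, which also lies in the edge just listed.\<close>

lemma dtrail_successively:
  "dtrail en a p U b \<Longrightarrow> successively (\<lambda>c d. en c \<inter> en d \<noteq> {}) p \<and> (p \<noteq> [] \<longrightarrow> a \<in> en (hd p))"
proof (induction rule: dtrail.induct)
  case (move c a b p U z)
  then have "b \<in> en c"
    by simp
  then show ?case
    using move by (auto simp: successively_Cons)
next
  case (stay a c p U z)
  then show ?case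
    by (auto simp: successively_Cons)
qed simp

text \<open>The classical passage from a dominating trail to a hamiltonian path of the line graph:
  an edge that is not yet listed but has a visited end is inserted by \<open>stay\<close> at a visit
  of that end.\<close>

lemma dtrail_extend:
  assumes "dtrail en a p U b" "distinct p" "finite E" "set p \<inter> E = {}" "\<And>c. c \<in> E \<Longrightarrow> en c \<inter> U \<noteq> {}"
  obtains q where "dtrail en a q U b" "distinct q" "set q = set p \<union> E"
proof -
  have "\<exists>q. dtrail en a q U b \<and> distinct q \<and> set q = set p \<union> E"
    using assms(3-5)
  proof (induction rule: finite_induct)
    case empty
    then show ?case
      using assms(1,2) by auto
  next
    case (insert c E)
    then obtain q where q: "dtrail en a q U b" "distinct q" "set q = set p \<union> E"
      by auto
    obtain x where x: "x \<in> en c" "x \<in> U"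
      using insert.prems by blast
    have "dtrail en x [c] {x} x"
      using x(1) by (simp add: dtrail.nil dtrail.stay)
    then obtain r where r: "dtrail en a r (U \<union> {x}) b" "mset r = mset q + mset [c]"
      using dtrail_splice[OF q(1) x(2)] by blast
    have "mset r = mset (c # q)"
      using r(2) by simp
    moreover have "distinct (c # q)"
      using q insert by auto
    ultimately have "distinct r" "set r = set (c # q)"
      by (metis mset_eq_imp_distinct_iff, metis mset_eq_setD)
    then show ?case
      using r(1) x(2) q(3) by (auto simp: insert_absorb)
  qed
  then show thesis
    using that by blast
qed

section \<open>Components of vertices of small degree\<close>

definition big :: "('v, 'e) mgraph \<Rightarrow> 'v set" where
  "big G = {v \<in> verts G. 3 \<le> degree G v}"

definition small :: "('v, 'e) mgraph \<Rightarrow> 'v set" where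
  "small G = verts G - big G"

abbreviation small_comp :: "('v, 'e) mgraph \<Rightarrow> 'v \<Rightarrow> 'v set" where
  "small_comp G \<equiv> component (small G) (adjacent G)"

abbreviation big_comp :: "('v, 'e) mgraph \<Rightarrow> 'v \<Rightarrow> 'v set" where
  "big_comp G \<equiv> component (big G) (adjacent G)"

definition attachments :: "('v, 'e) mgraph \<Rightarrow> 'v set \<Rightarrow> 'v set" where
  "attachments G C = {s \<in> big G. \<exists>c\<in>C. adjacent G c s}"

text \<open>
  A component of vertices of degree at most 2 is short for \<open>t\<close> if, after \<open>t\<close> line graph steps, what is
  left of it need not be traversed: either it has vanished, or it is no longer needed for
  connecting the vertices of degree at least 3 and a dominating trail may skip it. The slack 2 is
  what such a trail can dominate from both ends.
\<close>

definition short :: "nat \<Rightarrow> ('v, 'e) mgraph \<Rightarrow> 'v \<Rightarrow> bool" where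
  "short t G d \<longleftrightarrow> card (small_comp G d) \<le> t \<or>
     card (small_comp G d) \<le> t + 2 \<and>
     (\<forall>s\<in>attachments G (small_comp G d). \<forall>s'\<in>attachments G (small_comp G d).
       conn_in (big G) (adjacent G) s s')"

text \<open>At most two components of small vertices fail to be short; the representatives
  \<open>x\<close>, \<open>y\<close>, \<open>z\<close> spare counting sets of components.\<close>

definition few_long :: "nat \<Rightarrow> ('v, 'e) mgraph \<Rightarrow> bool" where
  "few_long t G \<longleftrightarrow> (\<forall>x\<in>small G. \<forall>y\<in>small G. \<forall>z\<in>small G.
     short t G x \<or> short t G y \<or> short t G z \<or>
     y \<in> small_comp G x \<or> z \<in> small_comp G x \<or> z \<in> small_comp G y)"

lemma symp_adjacent: "symp (adjacent G)"
  by (auto simp: symp_def adjacent_def insert_commute)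

lemma adjacent_sym: "adjacent G x y \<Longrightarrow> adjacent G y x"
  using symp_adjacent by (rule sympD)

lemma big_subset: "big G \<subseteq> verts G" and small_subset: "small G \<subseteq> verts G"
  by (auto simp: big_def small_def)

lemma small_not_big: "v \<in> small G \<Longrightarrow> v \<in> big G \<Longrightarrow> False"
  by (simp add: small_def)

lemmas comp_eq = component_eq[OF symp_adjacent]
  and comp_disjoint = component_disjoint[OF symp_adjacent]
  and comp_conn = component_conn[OF symp_adjacent]

lemma short_small_comp: "x \<in> small_comp G d \<Longrightarrow> short t G x \<longleftrightarrow> short t G d"
  by (simp add: short_def comp_eq)

lemma adjacent_irrefl: "multigraph G \<Longrightarrow> \<not> adjacent G x x"
  by (auto simp: multigraph_def adjacent_def)

lemma adjacent_verts: "multigraph G \<Longrightarrow> adjacent G x y \<Longrightarrow> x \<in> verts G \<and> y \<in> verts G"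
  by (auto simp: multigraph_def adjacent_def)

lemma nbrs_eq: "multigraph G \<Longrightarrow> nbrs G v = {u. adjacent G v u}"
  by (auto simp: nbrs_def dest: adjacent_verts)

lemma card_nbrs_le_degree:
  assumes "multigraph G"
  shows "card (nbrs G v) \<le> degree G v"
proof -
  have "\<forall>u\<in>nbrs G v. \<exists>e\<in>edges G. ends G e = {v, u}"
    by (auto simp: nbrs_def adjacent_def)
  then have "\<forall>u\<in>nbrs G v. \<exists>e. e \<in> edges G \<and> ends G e = {v, u}"
    by blast
  then obtain h where h: "\<And>u. u \<in> nbrs G v \<Longrightarrow> h u \<in> edges G \<and> ends G (h u) = {v, u}"
    using bchoice by (metis (no_types, lifting))
  have "inj_on h (nbrs G v)"
  proof (rule inj_onI)
    fix a b assume "a \<in> nbrs G v" "b \<in> nbrs G v" "h a = h b"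
    then have "{v, a} = {v, b}"
      using h by metis
    then show "a = b"
      by (auto simp: doubleton_eq_iff)
  qed
  moreover have "h ` nbrs G v \<subseteq> {e \<in> edges G. v \<in> ends G e}"
    using h by auto
  ultimately show ?thesis
    using assms unfolding degree_def by (intro card_inj_on_le) (auto simp: multigraph_def)
qed

lemma small_card_nbrs:
  "multigraph G \<Longrightarrow> d \<in> small G \<Longrightarrow> card {u. adjacent G d u} \<le> 2"
  using card_nbrs_le_degree[of G d] by (auto simp: small_def big_def nbrs_eq)

lemma finite_adjacent: "multigraph G \<Longrightarrow> finite {u. adjacent G d u}"
  using finite_subset[of "{u. adjacent G d u}" "verts G"] adjacent_verts multigraph_def by fastforce

lemma small_nbrs:
  assumes "multigraph G" "d \<in> small G" "adjacent G d a" "adjacent G d b" "adjacent G d c"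
  shows "a = b \<or> a = c \<or> b = c"
  using card_ge3I[OF finite_adjacent[OF assms(1)], of a b c d] small_card_nbrs[OF assms(1,2)] assms
  by fastforce

lemma finite_small_comp: "multigraph G \<Longrightarrow> d \<in> small G \<Longrightarrow> finite (small_comp G d)"
  by (meson component_subset finite_subset multigraph_def small_subset)

text \<open>The component is spanned by a path, and only the ends of the path can have big
  neighbours, so N(v) takes at most two vertices from it. If it takes two and the component has at
  most \<open>t + 2\<close> vertices, then \<open>v\<close> is the only possible attachment, which
  would make the component short.\<close>

lemma card_small_comp_Diff_nbrs:
  assumes mg: "multigraph G" and v: "v \<in> big G" and d: "d \<in> small G" and ns: "\<not> short t G d"
  shows "t \<le> card (small_comp G d - nbrs G v)"
proof -
  let ?C = "small_comp G d"
  note fin = finite_small_comp[OF mg d]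
  have ne: "?C \<noteq> {}"
    using component_refl[of d] by blast
  have sm: "c \<in> small G" if "c \<in> ?C" for c
    using component_subset[OF d] that by blast
  have le2: "card {y \<in> ?C. adjacent G x y} \<le> 2" if "x \<in> ?C" for x
    using card_mono[OF finite_adjacent[OF mg], of "{y \<in> ?C. adjacent G x y}" x]
      small_card_nbrs[OF mg sm[OF that]] by fastforce
  obtain w where w: "distinct w" "set w = ?C" "w \<noteq> []" "successively (adjacent G) w"
    and ext: "\<And>x. x \<in> ?C \<Longrightarrow> card {y \<in> ?C. adjacent G x y} \<le> 1 \<Longrightarrow> x = hd w \<or> x = last w"
    using spanning_path_if_degree_le_2[OF fin ne symp_adjacent adjacent_irrefl[OF mg] comp_conn[OF d] le2]
    by blast
  \<comment> \<open>Having at most two neighbours, a vertex with a big neighbour has at most one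
    neighbour inside the component, so it is an end of the path.\<close>
  have bd: "c = hd w \<or> c = last w" if c: "c \<in> ?C" "adjacent G c s" "s \<in> big G" for c s
  proof (rule ext[OF c(1)])
    have "insert s {y \<in> ?C. adjacent G c y} \<subseteq> {y. adjacent G c y}"
      using c by auto
    then have "card (insert s {y \<in> ?C. adjacent G c y}) \<le> 2"
      using order_trans[OF card_mono[OF finite_adjacent[OF mg]] small_card_nbrs[OF mg sm[OF c(1)]]] by simp
    moreover have "s \<notin> ?C"
      using c(3) small_not_big[OF sm] by blast
    ultimately show "card {y \<in> ?C. adjacent G c y} \<le> 1"
      using fin by simp
  qed
  have N: "?C \<inter> nbrs G v \<subseteq> {hd w, last w}"
    using bd[OF _ _ v] adjacent_sym by (fastforce simp: nbrs_eq[OF mg])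
  have eq: "card (?C - nbrs G v) = card ?C - card (?C \<inter> nbrs G v)"
    using fin by (simp add: card_Diff_subset_Int)
  have two: "card (?C \<inter> nbrs G v) \<le> 2"
    using card_mono[OF _ N] by (auto simp: card_insert_if split: if_splits)
  have gt: "t < card ?C" "t + 2 < card ?C \<or>
      \<not> (\<forall>s\<in>attachments G ?C. \<forall>s'\<in>attachments G ?C. conn_in (big G) (adjacent G) s s')"
    using ns by (auto simp: short_def)
  show ?thesis
  proof (cases "card (?C \<inter> nbrs G v) \<le> 1 \<or> t + 2 < card ?C")
    case True
    then show ?thesis
      using eq two gt by linarith
  next
    case False
    then have c2: "card (?C \<inter> nbrs G v) = 2"
      using two by linarith
    have neq: "hd w \<noteq> last w"
      using card_mono[OF _ N] c2 by auto
    have N': "?C \<inter> nbrs G v = {hd w, last w}"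
      using c2 neq by (intro card_subset_eq[OF _ N]) auto
    have "s = v" if s: "s \<in> attachments G ?C" for s
    proof -
      obtain c where c: "c \<in> ?C" "adjacent G c s" "s \<in> big G"
        using s by (auto simp: attachments_def)
      then have "c \<in> nbrs G v"
        using bd N' by blast
      then have cv: "adjacent G c v"
        by (simp add: nbrs_eq[OF mg] adjacent_sym)
      \<comment> \<open>Since there is a second vertex, \<open>c\<close> has a neighbour
        \<open>y\<close> inside the component. As \<open>y\<close> is small while \<open>s\<close>
        and \<open>v\<close> are big, the bound of two neighbours forces
        \<open>s = v\<close>.\<close>
      obtain c' where "c' \<in> ?C" "c' \<noteq> c"
        using neq w by (metis hd_in_set last_in_set)
      then obtain y where "y \<in> ?C" "adjacent G c y"
        using conn_in_leaves[OF comp_conn[OF d c(1)], of c' "{c}"] by auto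
      then show ?thesis
        using small_nbrs[OF mg sm[OF c(1)] c(2) cv] c(3) v small_not_big[OF sm] by blast
    qed
    then have "\<forall>s\<in>attachments G ?C. \<forall>s'\<in>attachments G ?C. conn_in (big G) (adjacent G) s s'"
      by (metis conn_in_refl)
    then show ?thesis
      using gt(2) False by blast
  qed
qed

text \<open>Three components that are not short would be disjoint and together keep at least
  \<open>3 * t\<close> vertices outside N(v). For big \<open>v\<close> each of them keeps at least
  \<open>t\<close>.\<close>

lemma few_long_if_card_less:
  assumes mg: "multigraph G" and v: "v \<in> verts G"
    and less: "card (small G - nbrs G v) < 3 * t"
  shows "few_long t G"
proof (rule ccontr)
  assume "\<not> few_long t G"
  then obtain x y z where xyz: "x \<in> small G" "y \<in> small G" "z \<in> small G"
      "\<not> short t G x" "\<not> short t G y" "\<not> short t G z"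
      "y \<notin> small_comp G x" "z \<notin> small_comp G x" "z \<notin> small_comp G y"
    unfolding few_long_def by blast
  let ?D = "\<lambda>d. small_comp G d - nbrs G v"
  have fin: "finite (?D d)" if "d \<in> small G" for d
    using finite_small_comp[OF mg that] by simp
  have "?D x \<union> ?D y \<union> ?D z \<subseteq> small G - nbrs G v"
    using xyz component_subset by fast
  then have "card (?D x \<union> ?D y \<union> ?D z) < 3 * t"
    using less mg by (meson card_mono finite_Diff finite_subset le_less_trans multigraph_def small_subset)
  moreover have "card (?D x \<union> ?D y \<union> ?D z) = card (?D x) + card (?D y) + card (?D z)"
  proof -
    have "?D x \<inter> ?D y = {}" "(?D x \<union> ?D y) \<inter> ?D z = {}"
      using comp_disjoint[OF xyz(7)] comp_disjoint[OF xyz(8)] comp_disjoint[OF xyz(9)] by blast+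
    then show ?thesis
      using fin xyz by (simp add: card_Un_disjoint)
  qed
  ultimately have sum: "card (?D x) + card (?D y) + card (?D z) < 3 * t"
    by simp
  show False
  proof (cases "v \<in> big G")
    case True
    then show False
      using sum card_small_comp_Diff_nbrs[OF mg True xyz(1,4)] card_small_comp_Diff_nbrs[OF mg True xyz(2,5)]
        card_small_comp_Diff_nbrs[OF mg True xyz(3,6)] by linarith
  next
    case False
    then have vs: "v \<in> small G"
      using v False by (simp add: small_def)
    have out: "t + 1 \<le> card (?D d)" if "d \<in> small G" "\<not> short t G d" "v \<notin> small_comp G d" for d
    proof -
      have "small_comp G d \<inter> nbrs G v = {}"
        using component_step[OF that(1) _ _ vs] that(3) by (auto simp: nbrs_eq[OF mg] dest: adjacent_sym)
      then have "?D d = small_comp G d"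
        by blast
      then show ?thesis
        using that by (auto simp: short_def)
    qed
    \<comment> \<open>For small \<open>v\<close>, at most one of the three components contains
      \<open>v\<close>. It may lose two neighbours of \<open>v\<close> and still keeps at least
      \<open>t - 1\<close> vertices, while the others keep at least \<open>t + 1\<close>
      each.\<close>
    have any: "t + 1 \<le> card (?D d) + 2" if "d \<in> small G" "\<not> short t G d" for d
    proof -
      have "t + 1 \<le> card (small_comp G d)"
        using that by (auto simp: short_def)
      moreover have "card (nbrs G v) \<le> 2"
        using small_card_nbrs[OF mg vs] by (simp add: nbrs_eq[OF mg])
      moreover have "card (small_comp G d) - card (nbrs G v) \<le> card (?D d)"
        by (rule diff_card_le_card_Diff) (simp add: nbrs_eq[OF mg] finite_adjacent[OF mg])
      ultimately show ?thesis
        by linarith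
    qed
    have "v \<notin> small_comp G x \<or> v \<notin> small_comp G y"
      "v \<notin> small_comp G x \<or> v \<notin> small_comp G z" "v \<notin> small_comp G y \<or> v \<notin> small_comp G z"
      using comp_disjoint[OF xyz(7)] comp_disjoint[OF xyz(8)] comp_disjoint[OF xyz(9)] by blast+
    then show False
      using sum out[OF xyz(1,4)] out[OF xyz(2,5)] out[OF xyz(3,6)]
        any[OF xyz(1,4)] any[OF xyz(2,5)] any[OF xyz(3,6)] by linarith
  qed
qed

section \<open>One line graph step\<close>

lemma connected_mgraph_conn_in:
  "connected_mgraph G \<Longrightarrow> x \<in> verts G \<Longrightarrow> y \<in> verts G \<Longrightarrow> conn_in UNIV (adjacent G) x y"
  by (simp add: connected_mgraph_def conn_in_def)

text \<open>
  \<open>H\<close> is a line graph of \<open>G\<close> whose vertices serve as names of the edges of \<open>G\<close>, with end sets \<open>en\<close>.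
\<close>

locale line_graph_of =
  fixes G :: "('v, 'e) mgraph" and H :: "('w, 'f) mgraph" and en :: "'w \<Rightarrow> 'v set"
  assumes multigraph_G: "multigraph G"
    and multigraph_H: "multigraph H"
    and en: "\<And>a. a \<in> verts H \<Longrightarrow> en a \<subseteq> verts G \<and> card (en a) = 2"
    and adjacent_G: "\<And>x y. adjacent G x y \<longleftrightarrow> (\<exists>a\<in>verts H. en a = {x, y})"
    and degree_G: "\<And>x. degree G x = card {a \<in> verts H. x \<in> en a}"
    and adjacent_H: "\<And>a b. a \<in> verts H \<Longrightarrow> b \<in> verts H \<Longrightarrow>
      adjacent H a b \<longleftrightarrow> a \<noteq> b \<and> en a \<inter> en b \<noteq> {}"
    and degree_H: "\<And>a. a \<in> verts H \<Longrightarrow> degree H a = card {b. adjacent H a b}"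
begin

section \<open>Stars, and how connectivity and small degrees pass to the line graph\<close>

definition star :: "'v \<Rightarrow> 'w set" where
  "star x = {a \<in> verts H. x \<in> en a}"

lemma finite_star: "finite (star x)"
  using multigraph_H by (simp add: star_def multigraph_def)

lemma card_star: "card (star x) = degree G x"
  by (simp add: star_def degree_G)

lemma verts_H_nonempty: "x \<in> big G \<Longrightarrow> verts H \<noteq> {}"
  using card_star[of x] by (force simp: big_def star_def)

lemma en_other:
  assumes "a \<in> verts H" "x \<in> en a"
  obtains y where "en a = {x, y}" "y \<noteq> x" "y \<in> verts G" "adjacent G x y"
proof -
  obtain u v where "en a = {u, v}" "u \<noteq> v"
    using en[OF assms(1)] by (auto simp: card_2_iff)
  then have "\<exists>y. en a = {x, y} \<and> y \<noteq> x"
    using assms(2) by auto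
  then show thesis
    using that en[OF assms(1)] adjacent_G assms(1) by (metis insert_subset)
qed

lemma adjacent_H_star:
  assumes "adjacent H a b"
  obtains x where "a \<in> star x" "b \<in> star x"
  using assms adjacent_H adjacent_verts[OF multigraph_H assms] by (auto simp: star_def)

lemma star_adjacent: "a \<in> star x \<Longrightarrow> b \<in> star x \<Longrightarrow> a \<noteq> b \<Longrightarrow> adjacent H a b"
  using adjacent_H by (auto simp: star_def)

text \<open>The edges traversed by a walk in \<open>P\<close> form a walk of the line graph, which
  \<open>PQ\<close> keeps inside \<open>Q\<close>. This is applied with \<open>P\<close> the set of
  all vertices, of small ones and of big ones.\<close>

lemma conn_in_lift:
  assumes conn: "conn_in P (adjacent G) x y"
    and PQ: "\<And>a. a \<in> verts H \<Longrightarrow> en a \<subseteq> P \<Longrightarrow> a \<in> Q" and Q: "Q \<subseteq> verts H"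
    and "a \<in> Q" "x \<in> en a" "b \<in> Q" "y \<in> en b"
  shows "conn_in Q (adjacent H) a b"
  using conn assms(6,7)
proof (induction arbitrary: b rule: conn_in_induct)
  case refl
  then show ?case
    using assms(4,5) Q star_adjacent[of a x b]
    by (cases "a = b") (auto simp: star_def intro: conn_in_step)
next
  case (step y z)
  obtain g where g: "g \<in> verts H" "en g = {y, z}"
    using step adjacent_G by blast
  then have gQ: "g \<in> Q"
    using PQ[OF g(1)] g(2) step.hyps(2,3) by simp
  have "conn_in Q (adjacent H) g b"
    using step gQ g Q star_adjacent[of g z b]
    by (cases "g = b") (auto simp: star_def intro: conn_in_step)
  moreover have "conn_in Q (adjacent H) a g"
    using step.IH gQ g by blast
  ultimately show ?case
    by (rule conn_in_trans[rotated])
qed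

lemma connected_H:
  assumes "connected_mgraph G" "verts H \<noteq> {}"
  shows "connected_mgraph H"
proof -
  have "(adjacent H)\<^sup>*\<^sup>* a b" if ab: "a \<in> verts H" "b \<in> verts H" for a b
  proof -
    obtain x y where "x \<in> en a" "y \<in> en b"
      using en ab by fastforce
    moreover from this have "conn_in UNIV (adjacent G) x y"
      using en ab connected_mgraph_conn_in[OF assms(1)] by blast
    ultimately have "conn_in (verts H) (adjacent H) a b"
      using ab by (intro conn_in_lift[of UNIV]) auto
    then show ?thesis
      using conn_in_mono[of "verts H" _ a b UNIV] by (simp add: conn_in_def)
  qed
  then show ?thesis
    using assms(2) by (simp add: connected_mgraph_def)
qed

text \<open>An end of degree at most 2 contributes at most one neighbour of \<open>a\<close> in
  \<open>H\<close>.\<close>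

lemma edge_small:
  assumes a: "a \<in> verts H" and sm: "en a \<subseteq> small G"
  shows "a \<in> small H"
proof -
  obtain x y where xy: "en a = {x, y}"
    using en[OF a] by (auto simp: card_2_iff)
  have le: "card (star z - {a}) \<le> 1" if "z \<in> en a" for z
    using that sm a card_star[of z] by (auto simp: star_def small_def big_def)
  have "{b. adjacent H a b} \<subseteq> (star x - {a}) \<union> (star y - {a})"
  proof
    fix b assume "b \<in> {b. adjacent H a b}"
    then have "adjacent H a b" by simp
    moreover from this obtain z where "a \<in> star z" "b \<in> star z"
      by (rule adjacent_H_star)
    ultimately show "b \<in> (star x - {a}) \<union> (star y - {a})"
      using xy adjacent_irrefl[OF multigraph_H] by (auto simp: star_def)
  qed
  then have "card {b. adjacent H a b} \<le> card ((star x - {a}) \<union> (star y - {a}))"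
    by (intro card_mono) (auto simp: finite_star)
  also have "\<dots> \<le> 1 + 1"
    using le xy by (intro order_trans[OF card_Un_le] add_mono) auto
  finally show ?thesis
    using a degree_H by (simp add: small_def big_def)
qed

text \<open>The other edges at \<open>x\<close>, at least two of them, are all adjacent to
  \<open>a\<close>, and \<open>a\<close> has no more than two neighbours; so there are exactly two
  and no further ones.\<close>

lemma small_at_big:
  assumes a: "a \<in> small H" "a \<in> star x" and x: "x \<in> big G"
  shows "{b. adjacent H a b} = star x - {a}" "card (star x) = 3"
proof -
  have 1: "star x - {a} \<subseteq> {b. adjacent H a b}"
    using star_adjacent a(2) by blast
  have 2: "card {b. adjacent H a b} \<le> 2"
    by (rule small_card_nbrs[OF multigraph_H a(1)])
  have 3: "3 \<le> card (star x)"
    using x card_star by (simp add: big_def)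
  have 4: "card (star x - {a}) = card (star x) - 1"
    using a(2) by (simp add: finite_star)
  have 5: "card (star x - {a}) \<le> card {b. adjacent H a b}"
    by (rule card_mono[OF finite_adjacent[OF multigraph_H] 1])
  show "{b. adjacent H a b} = star x - {a}"
    by (rule card_seteq[symmetric, OF finite_adjacent[OF multigraph_H] 1]) (use 2 3 4 in linarith)
  show "card (star x) = 3"
    using 2 3 4 5 by linarith
qed

end

locale connected_line_graph_of = line_graph_of +
  assumes connected_G: "connected_mgraph G"
    and big_G: "big G \<noteq> {}" and big_H: "big H \<noteq> {}"
begin

text \<open>By \<open>small_at_big\<close> no edge of \<open>H\<close> would leave the star, so
  connectivity would leave \<open>H\<close> with small vertices only, against
  \<open>big_H\<close>.\<close>

lemma star_not_small:
  assumes "a \<in> star x" "x \<in> big G"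
  shows "\<not> star x \<subseteq> small H"
proof
  assume sub: "star x \<subseteq> small H"
  obtain s where s: "s \<in> big H"
    using big_H by blast
  have "connected_mgraph H"
    using connected_H[OF connected_G] s big_subset[of H] by blast
  then have "conn_in UNIV (adjacent H) a s"
    using connected_mgraph_conn_in[of H a s] s big_subset[of H] assms(1) by (auto simp: star_def)
  moreover have "s \<notin> star x"
    using s sub small_not_big[of s H] by blast
  ultimately obtain u v where "u \<in> star x" "v \<notin> star x" "adjacent H u v"
    using conn_in_leaves[OF _ assms(1)] by blast
  then show False
    using small_at_big(1)[of u x] sub assms(2) by blast
qed

text \<open>
  An edge of \<open>G\<close> at a vertex of degree at least 3 rarely has degree at most 2 in \<open>H\<close>; when it does,
  it lies in a triangle, so it yields only short components.
\<close>

lemma short_at_big: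
  assumes a: "a \<in> small H" "a \<in> star x" and x: "x \<in> big G"
  shows "short t H a"
proof -
  \<comment> \<open>By \<open>small_at_big\<close> a small element of the star has all its
    neighbours in the star, so the component cannot leave it.\<close>
  have sub: "small_comp H a \<subseteq> star x \<inter> small H"
  proof
    fix b assume "b \<in> small_comp H a"
    then have "conn_in (small H) (adjacent H) a b"
      by (simp add: component_def)
    then show "b \<in> star x \<inter> small H"
    proof (induction rule: conn_in_induct)
      case refl
      then show ?case
        using a by simp
    next
      case (step y z)
      then show ?case
        using small_at_big(1)[of y x] x by blast
    qed
  qed
  \<comment> \<open>The star has three elements, not all of them small, so the component has at most
    two, which is within the slack for every \<open>t\<close>. Its attachments lie in the same star
    and are thus pairwise adjacent.\<close>
  have "small_comp H a \<noteq> star x"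
    using star_not_small[OF a(2) x] sub by blast
  then have "card (small_comp H a) < card (star x)"
    using sub by (intro psubset_card_mono finite_star) auto
  then have "card (small_comp H a) \<le> 2"
    using small_at_big(2)[OF a x] by simp
  moreover have "conn_in (big H) (adjacent H) s s'"
    if s: "s \<in> attachments H (small_comp H a)" "s' \<in> attachments H (small_comp H a)" for s s'
  proof -
    have "r \<in> star x" if "r \<in> attachments H (small_comp H a)" for r
      using that sub small_at_big(1)[OF _ _ x] by (fastforce simp: attachments_def)
    then have "s = s' \<or> adjacent H s s'"
      using s star_adjacent by blast
    then show ?thesis
      using s by (auto simp: attachments_def intro: conn_in_step)
  qed
  ultimately show ?thesis
    by (simp add: short_def)
qed

text \<open>If \<open>a\<close> were small, \<open>small_at_big\<close> at both ends would make the
  two stars equal: three parallel edges, all small in \<open>H\<close>. This contradicts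
  \<open>star_not_small\<close>.\<close>

lemma edge_big:
  assumes a: "a \<in> verts H" and bg: "en a \<subseteq> big G"
  shows "a \<in> big H"
proof (rule ccontr)
  assume "a \<notin> big H"
  then have sm: "a \<in> small H"
    using a by (simp add: small_def)
  obtain x y where xy: "en a = {x, y}" "x \<noteq> y"
    using en[OF a] by (auto simp: card_2_iff)
  have st: "a \<in> star x" "a \<in> star y"
    using a xy by (auto simp: star_def)
  have eq: "star x = star y"
    using small_at_big(1)[OF sm st(1)] small_at_big(1)[OF sm st(2)] bg xy st by blast
  have "b \<in> small H" if b: "b \<in> star x" for b
  proof -
    have bH: "b \<in> verts H"
      using b by (simp add: star_def)
    have "{x, y} \<subseteq> en b" "card (en b) = 2"
      using b eq en[OF bH] by (auto simp: star_def)
    then have enb: "en b = {x, y}"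
      using xy(2) by (metis card_2_iff card_subset_eq card.infinite zero_neq_numeral)
    have "{c. adjacent H b c} \<subseteq> star x - {b}"
    proof
      fix c assume "c \<in> {c. adjacent H b c}"
      then have "adjacent H b c" by simp
      moreover from this obtain z where "b \<in> star z" "c \<in> star z"
        by (rule adjacent_H_star)
      ultimately show "c \<in> star x - {b}"
        using enb eq adjacent_irrefl[OF multigraph_H] by (auto simp: star_def)
    qed
    then have "card {c. adjacent H b c} \<le> card (star x - {b})"
      by (intro card_mono) (auto simp: finite_star)
    also have "\<dots> = 2"
      using small_at_big(2)[OF sm st(1)] bg xy b by (simp add: finite_star)
    finally show ?thesis
      using bH degree_H by (simp add: small_def big_def)
  qed
  then show False
    using star_not_small[OF st(1)] bg xy by blast
qed

text \<open>By \<open>short_at_big\<close> a component that is not short consists of edges with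
  small ends only. They lie inside a single component of \<open>G\<close>, which has more vertices
  than there are such edges. So both size bounds in \<open>short\<close> drop by one, and connected
  attachments in \<open>G\<close> lift to connected attachments in \<open>H\<close>.\<close>

lemma not_short_H:
  assumes a: "a \<in> small H" and ns: "\<not> short t H a" and x: "x \<in> en a"
  shows "x \<in> small G" "\<not> short (Suc t) G x"
proof -
  let ?C' = "small_comp H a" and ?C = "small_comp G x"
  have C'H: "b \<in> verts H" "b \<in> small H" if "b \<in> ?C'" for b
    using that component_subset[OF a] small_subset[of H] by blast+
  have aH: "a \<in> verts H"
    using C'H by simp
  have sm: "en b \<subseteq> small G" if b: "b \<in> ?C'" for b
  proof
    fix z assume z: "z \<in> en b"
    have "z \<notin> big G"
      using short_at_big[OF C'H(2)[OF b], of z t] C'H(1)[OF b] z ns short_small_comp[OF b]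
      by (auto simp: star_def)
    then show "z \<in> small G"
      using en[OF C'H(1)[OF b]] z by (auto simp: small_def)
  qed
  show xs: "x \<in> small G"
    using sm[of a] x by auto
  have ext: "en b \<subseteq> ?C" if b: "b \<in> verts H" "en b \<subseteq> small G" "z \<in> en b" "z \<in> ?C" for b z
  proof -
    obtain y where "en b = {z, y}" "adjacent G z y"
      using en_other[OF b(1,3)] by metis
    then show ?thesis
      using component_step[OF xs b(4)] b by auto
  qed
  have inC: "en b \<subseteq> ?C" if "b \<in> ?C'" for b
  proof -
    have "conn_in (small H) (adjacent H) a b"
      using that by (simp add: component_def)
    then have "b \<in> ?C' \<and> en b \<subseteq> ?C"
    proof (induction rule: conn_in_induct)
      case refl
      then show ?case
        using ext[OF aH sm x] by simp
    next
      case (step b c)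
      then have c: "c \<in> ?C'"
        using component_step[OF a] by blast
      obtain z where "b \<in> star z" "c \<in> star z"
        using adjacent_H_star step by blast
      then show ?case
        using ext[OF C'H(1)[OF c] sm[OF c], of z] step c by (auto simp: star_def)
    qed
    then show ?thesis ..
  qed
  note finC = finite_small_comp[OF multigraph_G xs]
  note finC' = finite_small_comp[OF multigraph_H a]
  \<comment> \<open>Counting incidences: the component \<open>?C\<close> has degrees at most 2 and an edge leaving it, so it
    spans fewer than \<open>card ?C\<close> edges.\<close>
  have "2 * card ?C' = (\<Sum>b\<in>?C'. 2)"
    by simp
  also have "\<dots> = (\<Sum>z\<in>?C. card {b \<in> ?C'. z \<in> en b})"
  proof (rule sum_multicount_gen[symmetric, OF finC finC'], rule ballI)
    fix b assume b: "b \<in> ?C'"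
    then have "{z \<in> ?C. z \<in> en b} = en b"
      using inC by blast
    then show "card {z \<in> ?C. z \<in> en b} = 2"
      using en[OF C'H(1)[OF b]] by simp
  qed
  also have "\<dots> < (\<Sum>z\<in>?C. 2)"
  proof (rule sum_strict_mono_ex1[OF finC])
    have le: "{b \<in> ?C'. z \<in> en b} \<subseteq> star z" for z
      using C'H by (auto simp: star_def)
    have deg: "card (star z) \<le> 2" if "z \<in> ?C" for z
    proof -
      have "z \<in> small G"
        using that component_subset[OF xs] by blast
      then show ?thesis
        by (auto simp: card_star small_def big_def)
    qed
    show "\<forall>z\<in>?C. card {b \<in> ?C'. z \<in> en b} \<le> 2"
      using card_mono[OF finite_star le] deg by (meson le_trans)
    obtain s where s: "s \<in> big G"
      using big_G by blast
    have xs': "conn_in UNIV (adjacent G) x s"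
      using connected_mgraph_conn_in[OF connected_G] s xs small_subset[of G] big_subset[of G] by blast
    have "s \<notin> ?C"
      using s component_subset[OF xs] small_not_big[of s G] by blast
    then obtain z u where zu: "z \<in> ?C" "u \<notin> ?C" "adjacent G z u"
      using conn_in_leaves[OF xs' component_refl] by blast
    then obtain g where g: "g \<in> verts H" "en g = {z, u}"
      using adjacent_G by blast
    have "g \<notin> ?C'"
      using inC[of g] g(2) zu(2) by auto
    then have "{b \<in> ?C'. z \<in> en b} \<subseteq> star z - {g}"
      using le[of z] by blast
    then have "card {b \<in> ?C'. z \<in> en b} \<le> card (star z - {g})"
      by (intro card_mono) (auto simp: finite_star)
    also have "\<dots> < card (star z)"
      using g by (intro card_Diff1_less finite_star) (auto simp: star_def)
    finally show "\<exists>z\<in>?C. card {b \<in> ?C'. z \<in> en b} < 2"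
      using deg zu by (meson order_less_le_trans)
  qed
  finally have less: "card ?C' < card ?C"
    by simp
  show "\<not> short (Suc t) G x"
  proof
    assume sh: "short (Suc t) G x"
    have "t < card ?C'"
      using ns by (auto simp: short_def)
    then have le: "card ?C \<le> Suc t + 2"
      and conn: "\<And>s s'. s \<in> attachments G ?C \<Longrightarrow> s' \<in> attachments G ?C \<Longrightarrow>
        conn_in (big G) (adjacent G) s s'"
      using sh less by (auto simp: short_def)
    \<comment> \<open>An attachment in \<open>H\<close> is an edge with one end in
      \<open>?C\<close>; its other end is big, since by \<open>edge_small\<close> the edge would
      otherwise be small.\<close>
    have bd: "\<exists>s. s \<in> en e \<and> s \<in> attachments G ?C" if e: "e \<in> attachments H ?C'" for e
    proof -
      obtain b where b: "b \<in> ?C'" "adjacent H b e" "e \<in> big H"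
        using e by (auto simp: attachments_def)
      obtain z where z: "b \<in> star z" "e \<in> star z"
        using adjacent_H_star b by blast
      have eH: "e \<in> verts H" "z \<in> en e"
        using z by (auto simp: star_def)
      then obtain s where s: "en e = {z, s}" "s \<in> verts G" "adjacent G z s"
        using en_other by metis
      have zC: "z \<in> ?C"
        using inC[OF b(1)] z by (auto simp: star_def)
      have "s \<in> big G"
      proof (rule ccontr)
        assume "s \<notin> big G"
        then have "en e \<subseteq> small G"
          using s zC component_subset[OF xs] by (auto simp: small_def)
        then show False
          using edge_small[OF eH(1)] b(3) small_not_big[of e H] by blast
      qed
      then show ?thesis
        using s zC by (auto simp: attachments_def)
    qed
    have "conn_in (big H) (adjacent H) e f" if ef: "e \<in> attachments H ?C'" "f \<in> attachments H ?C'" for e f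
    proof -
      obtain s s' where "s \<in> en e" "s \<in> attachments G ?C" "s' \<in> en f" "s' \<in> attachments G ?C"
        using bd ef by blast
      then show ?thesis
        using conn_in_lift[OF conn edge_big big_subset, where x = s and y = s' and a = e and b = f] ef
        by (auto simp: attachments_def)
    qed
    then show False
      using ns less le by (auto simp: short_def)
  qed
qed

text \<open>Components that are not short come from such components of \<open>G\<close> by
  \<open>not_short_H\<close>. Different ones come from different ones, because
  \<open>edge_small\<close> lifts a connection through small vertices.\<close>

lemma few_long_H:
  assumes "few_long (Suc t) G"
  shows "few_long t H"
proof (rule ccontr)
  assume "\<not> few_long t H"
  then obtain a b c where abc: "a \<in> small H" "b \<in> small H" "c \<in> small H"
      "\<not> short t H a" "\<not> short t H b" "\<not> short t H c"
    and sep: "b \<notin> small_comp H a" "c \<notin> small_comp H a" "c \<notin> small_comp H b"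
    unfolding few_long_def by blast
  have en_nonempty: "\<exists>x. x \<in> en a" if "a \<in> small H" for a
    using en[of a] that small_subset[of H] by (cases "en a = {}") auto
  obtain x y z where xyz: "x \<in> en a" "y \<in> en b" "z \<in> en c"
    using en_nonempty abc(1-3) by metis
  have sep': "v \<notin> small_comp G u"
    if "a' \<in> small H" "b' \<in> small H" "u \<in> en a'" "v \<in> en b'" "b' \<notin> small_comp H a'" for a' b' u v
  proof
    assume "v \<in> small_comp G u"
    then have "conn_in (small G) (adjacent G) u v"
      by (simp add: component_def)
    then have "conn_in (small H) (adjacent H) a' b'"
      using conn_in_lift[OF _ edge_small small_subset, where x = u and y = v and a = a' and b = b'] that
      by blast
    then show False
      using that by (simp add: component_def)
  qed
  show False
    using assms not_short_H[OF abc(1,4) xyz(1)] not_short_H[OF abc(2,5) xyz(2)]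
      not_short_H[OF abc(3,6) xyz(3)] sep'[OF abc(1,2) xyz(1,2) sep(1)]
      sep'[OF abc(1,3) xyz(1,3) sep(2)] sep'[OF abc(2,3) xyz(2,3) sep(3)]
    unfolding few_long_def by blast
qed

end

section \<open>Trails in line graphs of simple graphs\<close>

locale double_line_graph_of = connected_line_graph_of G H en + L2: line_graph_of H K en2
  for G :: "('v, 'e) mgraph" and H :: "('w, 'f) mgraph" and en :: "'w \<Rightarrow> 'v set"
    and K :: "('u, 'g) mgraph" and en2 :: "'u \<Rightarrow> 'w set" +
  assumes inj_en: "inj_on en (verts H)"
begin

definition stars :: "'v set \<Rightarrow> 'w set" where
  "stars X = (\<Union>x\<in>X. star x)"

text \<open>
  Every edge of \<open>H\<close> joins two edges of \<open>G\<close> with a unique common vertex, as \<open>G\<close> is simple here. Hence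
  tours centered at disjoint vertex sets are edge-disjoint and can be concatenated.
\<close>

definition centered :: "'v set \<Rightarrow> 'u set" where
  "centered X = {c \<in> verts K. \<exists>x\<in>X. en2 c \<subseteq> star x}"

definition tour :: "'v set \<Rightarrow> 'w \<Rightarrow> 'w set \<Rightarrow> 'w \<Rightarrow> bool" where
  "tour X a U b \<longleftrightarrow> (\<exists>p. dtrail en2 a p U b \<and> distinct p \<and> set p \<subseteq> centered X)"

lemma stars_Un_Union: "stars (X \<union> \<Union>\<Y>) = stars X \<union> \<Union>(stars ` \<Y>)"
  by (auto simp: stars_def)

text \<open>Otherwise \<open>a\<close> and \<open>b\<close> would both join \<open>x\<close> and
  \<open>y\<close>, but \<open>inj_en\<close> excludes parallel edges.\<close>

lemma star_Int:
  assumes "a \<in> star x" "a \<in> star y" "b \<in> star x" "b \<in> star y" "x \<noteq> y"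
  shows "a = b"
proof -
  have "en c = {x, y}" if "c \<in> star x" "c \<in> star y" for c
    using that en[of c] assms(5) card_seteq[of "en c" "{x, y}"]
    by (auto simp: star_def card_2_iff)
  then have "en a = en b"
    using assms by simp
  then show ?thesis
    using assms inj_onD[OF inj_en] by (simp add: star_def)
qed

lemma centered_disjoint:
  assumes "X \<inter> Y = {}"
  shows "centered X \<inter> centered Y = {}"
proof (rule ccontr)
  assume "centered X \<inter> centered Y \<noteq> {}"
  then obtain c x y where c: "c \<in> verts K" "x \<in> X" "y \<in> Y" "en2 c \<subseteq> star x" "en2 c \<subseteq> star y"
    by (auto simp: centered_def)
  then obtain a b where "en2 c = {a, b}" "a \<noteq> b"
    using L2.en[of c] by (auto simp: card_2_iff)
  then show False
    using c assms star_Int[of a x y b] by auto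
qed

lemma centered_Un: "centered (X \<union> Y) = centered X \<union> centered Y"
  by (auto simp: centered_def)

section \<open>Composing tours\<close>

lemma tour_refl: "tour {} a {a} a"
  unfolding tour_def by (intro exI[of _ "[]"]) (simp add: dtrail.nil)

lemma tour_append:
  assumes "tour X a U b" "tour Y b W c" "X \<inter> Y = {}"
  shows "tour (X \<union> Y) a (U \<union> W) c"
proof -
  obtain p q where "dtrail en2 a p U b" "distinct p" "set p \<subseteq> centered X"
      "dtrail en2 b q W c" "distinct q" "set q \<subseteq> centered Y"
    using assms by (auto simp: tour_def)
  then show ?thesis
    using centered_disjoint[OF assms(3)] unfolding tour_def centered_Un
    by (intro exI[of _ "p @ q"]) (auto intro: dtrail_append)
qed

lemma tour_splice:
  assumes "tour X a U b" "x \<in> U" "tour Y x W x" "X \<inter> Y = {}"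
  shows "tour (X \<union> Y) a (U \<union> W) b"
proof -
  obtain p q where pq: "dtrail en2 a p U b" "distinct p" "set p \<subseteq> centered X"
      "dtrail en2 x q W x" "distinct q" "set q \<subseteq> centered Y"
    using assms by (auto simp: tour_def)
  obtain r where r: "dtrail en2 a r (U \<union> W) b" "mset r = mset p + mset q"
    using dtrail_splice[OF pq(1) assms(2) pq(4)] .
  have mset: "mset r = mset (p @ q)"
    using r by simp
  have "distinct (p @ q)"
    using pq centered_disjoint[OF assms(4)] by auto
  then have "distinct r" "set r = set (p @ q)"
    using mset mset_eq_imp_distinct_iff mset_eq_setD by blast+
  then show ?thesis
    using r pq unfolding tour_def centered_Un by (intro exI[of _ r]) auto
qed

lemma edge_between:
  assumes "a \<in> star x" "b \<in> star x" "a \<noteq> b" "x \<in> X"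
  obtains c where "c \<in> centered X" "en2 c = {a, b}"
proof -
  obtain c where "c \<in> verts K" "en2 c = {a, b}"
    using star_adjacent[OF assms(1-3)] L2.adjacent_G by blast
  then show thesis
    using that[of c] assms by (auto simp: centered_def)
qed

text \<open>The bound on \<open>en2 c\<close> is there for the induction: the edge put in front
  contains \<open>a\<close>, which no later edge does, so it is new.\<close>

lemma dtrail_path:
  assumes "distinct w" "w \<noteq> []" "successively (\<lambda>a b. \<exists>x\<in>X. a \<in> star x \<and> b \<in> star x) w"
  shows "\<exists>p. dtrail en2 (hd w) p (set w) (last w) \<and> distinct p \<and>
    (\<forall>c\<in>set p. c \<in> centered X \<and> en2 c \<subseteq> set w)"
  using assms
proof (induction w rule: induct_list012)
  case (2 a)
  then show ?case
    by (intro exI[of _ "[]"]) (simp add: dtrail.nil)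
next
  case (3 a b w)
  then obtain p where p: "dtrail en2 b p (set (b # w)) (last (b # w))" "distinct p"
      "\<forall>c\<in>set p. c \<in> centered X \<and> en2 c \<subseteq> set (b # w)"
    by auto
  obtain x where "x \<in> X" "a \<in> star x" "b \<in> star x"
    using 3 by auto
  then obtain c where c: "c \<in> centered X" "en2 c = {a, b}"
    using edge_between[of a x b X] 3 by auto
  have "a \<notin> set (b # w)"
    using 3 by simp
  then have "c \<notin> set p"
    using p(3) c(2) by blast
  then show ?case
    using p c dtrail.move[OF c(2) p(1)] by (intro exI[of _ "c # p"]) auto
qed simp

lemma tour_path:
  "distinct w \<Longrightarrow> w \<noteq> [] \<Longrightarrow> successively (\<lambda>a b. \<exists>x\<in>X. a \<in> star x \<and> b \<in> star x) w \<Longrightarrow>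
    tour X (hd w) (set w) (last w)"
  using dtrail_path[of w X] unfolding tour_def by blast

text \<open>In a clique every ordering is a path, so both ends can be prescribed.\<close>

lemma dtrail_clique:
  assumes "T \<subseteq> star x" "u \<in> T" "v \<in> T" "u \<noteq> v"
  shows "\<exists>p. dtrail en2 u p T v \<and> distinct p \<and> (\<forall>c\<in>set p. c \<in> centered {x} \<and> en2 c \<subseteq> T)"
proof -
  have "finite T"
    using assms(1) finite_star finite_subset by blast
  then obtain l where l: "distinct l" "set l = T - {u, v}"
    using finite_distinct_list by (meson finite_Diff)
  let ?w = "u # l @ [v]"
  have T: "set ?w = T"
    using assms l by auto
  have "successively (\<lambda>a b. \<exists>y\<in>{x}. a \<in> star y \<and> b \<in> star y) ?w"
    using T assms(1) by (intro successively_if_all) auto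
  moreover have "distinct ?w"
    using assms l by auto
  ultimately show ?thesis
    using dtrail_path[of ?w "{x}"] T by simp
qed

text \<open>
  The edges at a vertex of degree at least 3 form a clique of the line graph, which has a
  hamiltonian path between any two of its vertices and also a hamiltonian cycle.
\<close>

lemma tour_star:
  assumes x: "x \<in> big G" and a: "a \<in> star x" and b: "b \<in> star x"
  shows "tour {x} a (star x) b"
proof (cases "a = b")
  case False
  obtain p where "dtrail en2 a p (star x) b" "distinct p"
    "\<forall>c\<in>set p. c \<in> centered {x} \<and> en2 c \<subseteq> star x"
    using dtrail_clique[OF order_refl a b False] by blast
  then show ?thesis
    unfolding tour_def by blast
next
  case True
  \<comment> \<open>The closed tour goes from \<open>a\<close> to \<open>u\<close>, through the rest
    of the clique to \<open>v\<close> and back. Three elements ensure that \<open>u\<close> and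
    \<open>v\<close> differ, so two different edges are used at \<open>a\<close>.\<close>
  have "3 \<le> card (star x)"
    using x by (simp add: big_def card_star)
  then have "2 \<le> card (star x - {a})"
    using a by (simp add: finite_star)
  then have "\<not> card (star x - {a}) \<le> Suc 0"
    by simp
  then obtain u v where uv: "u \<in> star x - {a}" "v \<in> star x - {a}" "u \<noteq> v"
    using card_le_Suc0_iff_eq[of "star x - {a}"] by (auto simp: finite_star)
  obtain p where p: "dtrail en2 u p (star x - {a}) v" "distinct p"
      "\<forall>c\<in>set p. c \<in> centered {x} \<and> en2 c \<subseteq> star x - {a}"
    using dtrail_clique[OF Diff_subset uv] by blast
  obtain c where c: "c \<in> centered {x}" "en2 c = {a, u}"
    using edge_between[of a x u "{x}"] a uv by auto
  obtain d where d: "d \<in> centered {x}" "en2 d = {v, a}"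
    using edge_between[of v x a "{x}"] a uv by auto
  have "dtrail en2 v [d] {v, a} a"
    using dtrail.move[where en = en2, OF d(2) dtrail.nil[of _ a]] .
  then have "dtrail en2 a (c # p @ [d]) (insert a ((star x - {a}) \<union> {v, a})) a"
    using p(1) by (intro dtrail.move[where en = en2, OF c(2)] dtrail_append)
  moreover have "insert a ((star x - {a}) \<union> {v, a}) = star x"
    using a uv by blast
  moreover have "distinct (c # p @ [d])"
    using p(2,3) c d uv by (auto simp: doubleton_eq_iff)
  ultimately show ?thesis
    using True c d p(3) unfolding tour_def by (intro exI[of _ "c # p @ [d]"]) auto
qed

text \<open>A largest \<open>N\<close> with tours between all pairs must be \<open>M\<close>.
  Otherwise some vertex \<open>v\<close> of \<open>M\<close> adjacent to \<open>N\<close> can be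
  added: the edge \<open>g\<close> joining it to \<open>N\<close> belongs to the stars of both
  sides, so their tours meet at \<open>g\<close>.\<close>

lemma tour_connected:
  assumes M: "M \<subseteq> big G" "x0 \<in> M" "\<And>y. y \<in> M \<Longrightarrow> conn_in M (adjacent G) x0 y"
    and ab: "a \<in> stars M" "b \<in> stars M"
  shows "tour M a (stars M) b"
proof -
  define Q where "Q N \<longleftrightarrow> N \<subseteq> M \<and> x0 \<in> N \<and> (\<forall>a\<in>stars N. \<forall>b\<in>stars N. tour N a (stars N) b)" for N
  have finM: "finite M"
    using M(1) multigraph_G big_subset[of G] by (meson finite_subset multigraph_def)
  have "Q {x0}"
    using M tour_star by (auto simp: Q_def stars_def)
  moreover have "card N \<le> card M" if "Q N" for N
    using that finM by (auto simp: Q_def intro: card_mono)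
  ultimately have "\<exists>N. Q N \<and> (\<forall>N'. Q N' \<longrightarrow> card N' \<le> card N)"
    by (intro ex_has_greatest_nat[where b = "Suc (card M)"]) (auto simp: less_Suc_eq_le)
  then obtain N where N: "Q N" and mx: "\<And>N'. Q N' \<Longrightarrow> card N' \<le> card N"
    by blast
  have "N = M"
  proof (rule ccontr)
    assume "N \<noteq> M"
    then obtain y0 where y0: "y0 \<in> M" "y0 \<notin> N"
      using N by (auto simp: Q_def)
    moreover have "x0 \<in> N"
      using N by (simp add: Q_def)
    ultimately obtain u v where uv: "u \<in> N" "v \<notin> N" "v \<in> M" "adjacent G u v"
      using conn_in_leaves[OF M(3)] by metis
    obtain g where "g \<in> verts H" "en g = {u, v}"
      using uv adjacent_G by blast
    then have g: "g \<in> stars N" "g \<in> star v"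
      using uv by (auto simp: stars_def star_def)
    have tv: "tour {v} a (star v) b" if "a \<in> star v" "b \<in> star v" for a b
      using tour_star that uv M by blast
    have tN: "tour N a (stars N) b" if "a \<in> stars N" "b \<in> stars N" for a b
      using N that by (simp add: Q_def)
    have dj: "N \<inter> {v} = {}" "{v} \<inter> N = {}"
      using uv by auto
    \<comment> \<open>If \<open>a\<close> and \<open>b\<close> are on the same side, a closed tour
      of the other side is spliced in at \<open>g\<close>; if they are on different sides, two tours
      are concatenated at \<open>g\<close>.\<close>
    have "tour (N \<union> {v}) a (stars N \<union> star v) b"
      if "a \<in> stars N \<or> a \<in> star v" "b \<in> stars N \<or> b \<in> star v" for a b
    proof -
      consider "a \<in> stars N" "b \<in> stars N" | "a \<in> stars N" "b \<in> star v"
        | "a \<in> star v" "b \<in> stars N" | "a \<in> star v" "b \<in> star v"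
        using \<open>a \<in> stars N \<or> a \<in> star v\<close> \<open>b \<in> stars N \<or> b \<in> star v\<close> by blast
      then show ?thesis
      proof cases
        case 1
        then show ?thesis
          using tour_splice[OF tN[of a b] g(1) tv[of g g] dj(1)] g by blast
      next
        case 2
        then show ?thesis
          using tour_append[OF tN[of a g] tv[of g b] dj(1)] g by blast
      next
        case 3
        then show ?thesis
          using tour_append[OF tv[of a g] tN[of g b] dj(2)] g by (simp add: Un_commute)
      next
        case 4
        then show ?thesis
          using tour_splice[OF tv[of a b] g(2) tN[of g g] dj(2)] g by (simp add: Un_commute)
      qed
    qed
    moreover have "stars (insert v N) = stars N \<union> star v"
      by (auto simp: stars_def)
    ultimately have "Q (insert v N)"
      using N uv by (auto simp: Q_def)
    then have "card (insert v N) \<le> card N"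
      by (rule mx)
    then show False
      using uv N finM by (auto simp: Q_def dest: finite_subset)
  qed
  then show ?thesis
    using N ab by (simp add: Q_def)
qed

lemma tour_big_comp:
  assumes "s \<in> big G" "a \<in> stars (big_comp G s)" "b \<in> stars (big_comp G s)"
  shows "tour (big_comp G s) a (stars (big_comp G s)) b"
  using tour_connected[OF component_subset component_refl comp_conn[OF _ component_refl]] assms
  by blast

text \<open>The tour runs from \<open>p\<close> to \<open>a\<close>, then through all edges at the
  component of \<open>m\<close> to \<open>b\<close>, and on to \<open>q\<close>. Every other
  component of big vertices meets \<open>U1\<close> or \<open>U2\<close> by \<open>touch\<close>,
  and its closed tour is spliced in there. The sets of centres are disjoint, so no edge of
  \<open>H\<close> is repeated.\<close>

lemma tour_join:
  assumes t1: "tour X1 p U1 a" and t2: "tour X2 b U2 q"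
    and X: "X1 \<subseteq> small G" "X2 \<subseteq> small G" "X1 \<inter> X2 = {}"
    and m: "m \<in> big G" "a \<in> stars (big_comp G m)" "b \<in> stars (big_comp G m)"
    and touch: "\<And>s. s \<in> big G \<Longrightarrow> s \<notin> big_comp G m \<Longrightarrow> stars (big_comp G s) \<inter> (U1 \<union> U2) \<noteq> {}"
  obtains U where "tour (X1 \<union> X2 \<union> big G) p U q" "U1 \<union> U2 \<union> stars (big G) \<subseteq> U"
proof -
  let ?M = "big_comp G m"
  define U where "U = U1 \<union> stars ?M \<union> U2"
  have M: "?M \<subseteq> big G"
    by (rule component_subset[OF m(1)])
  have dj: "X \<inter> Y = {}" if "X \<subseteq> small G" "Y \<subseteq> big G" for X Y
    using that small_not_big[of _ G] by blast
  have base: "tour (X1 \<union> ?M \<union> X2) p U q"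
  proof -
    have "tour (X1 \<union> ?M) p (U1 \<union> stars ?M) b"
      using tour_append[OF t1 tour_big_comp[OF m] dj[OF X(1) M]] .
    moreover have "(X1 \<union> ?M) \<inter> X2 = {}"
      using X(3) dj[OF X(2) M] by blast
    ultimately show ?thesis
      using tour_append t2 by (auto simp: U_def)
  qed
  have family: "tour (X1 \<union> ?M \<union> X2 \<union> \<Union>\<N>) p (U \<union> \<Union>(stars ` \<N>)) q"
    if "finite \<N>" "\<N> \<subseteq> big_comp G ` big G - {?M}" for \<N>
    using that
  proof (induction rule: finite_induct)
    case empty
    then show ?case
      using base by simp
  next
    case (insert N \<N>)
    then obtain s where s: "s \<in> big G" "N = big_comp G s" "N \<noteq> ?M"
      by auto
    have disj: "N \<inter> N' = {}" if "N' \<in> insert ?M \<N>" for N'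
    proof -
      have "N' \<in> big_comp G ` big G"
        using that insert.prems m(1) by blast
      then obtain s' where s': "s' \<in> big G" "N' = big_comp G s'"
        by blast
      have "N' \<noteq> N"
        using that s insert.hyps by auto
      then have "s' \<notin> big_comp G s"
        using comp_eq[of s' "big G" G s] s(2) s'(2) by blast
      then show ?thesis
        using comp_disjoint s(2) s'(2) by metis
    qed
    have "N \<subseteq> big G"
      using s component_subset by metis
    then have "(X1 \<union> ?M \<union> X2 \<union> \<Union>\<N>) \<inter> N = {}"
      using disj dj[OF X(1), of N] dj[OF X(2), of N] by blast
    moreover have "s \<notin> ?M"
      using s comp_eq[of s "big G" G m] by blast
    then obtain e where "e \<in> stars N" "e \<in> U"
      using touch[OF s(1)] s(2) by (auto simp: U_def)
    ultimately have "tour (X1 \<union> ?M \<union> X2 \<union> \<Union>\<N> \<union> N) p (U \<union> \<Union>(stars ` \<N>) \<union> stars N) q"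
      using tour_splice[OF insert.IH, of e N "stars N"] tour_big_comp[OF s(1), of e e] s(2) insert.prems
      by auto
    then show ?case
      by (simp add: Un_ac)
  qed
  have "finite (big_comp G ` big G - {?M})"
    using multigraph_G big_subset[of G] by (meson finite_Diff finite_imageI finite_subset multigraph_def)
  then have t: "tour (X1 \<union> ?M \<union> X2 \<union> \<Union>(big_comp G ` big G - {?M})) p
      (U \<union> \<Union>(stars ` (big_comp G ` big G - {?M}))) q"
    using family order_refl by meson
  have un: "?M \<union> \<Union>(big_comp G ` big G - {?M}) = big G"
  proof
    show "?M \<union> \<Union>(big_comp G ` big G - {?M}) \<subseteq> big G"
      using M component_subset[of _ "big G"] by blast
    show "big G \<subseteq> ?M \<union> \<Union>(big_comp G ` big G - {?M})"
    proof
      fix s assume s: "s \<in> big G"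
      have "s \<in> big_comp G s"
        by simp
      then show "s \<in> ?M \<union> \<Union>(big_comp G ` big G - {?M})"
        using s by (cases "big_comp G s = ?M") (blast, blast)
    qed
  qed
  have eq1: "X1 \<union> ?M \<union> X2 \<union> \<Union>(big_comp G ` big G - {?M}) = X1 \<union> X2 \<union> big G"
    using un by blast
  have "stars ?M \<union> \<Union>(stars ` (big_comp G ` big G - {?M})) = stars (big G)"
    using stars_Un_Union[of ?M "big_comp G ` big G - {?M}"] un by metis
  then have "U1 \<union> U2 \<union> stars (big G) \<subseteq> U \<union> \<Union>(stars ` (big_comp G ` big G - {?M}))"
    unfolding U_def by blast
  then show thesis
    using that t unfolding eq1 by metis
qed

section \<open>Dominating tours\<close>

lemma stars_edge:
  assumes "adjacent G x y" "x \<in> X" "y \<in> Y"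
  shows "stars X \<inter> stars Y \<noteq> {}"
proof -
  obtain g where "g \<in> verts H" "en g = {x, y}"
    using assms(1) adjacent_G by blast
  then show ?thesis
    using assms by (auto simp: stars_def star_def)
qed

text \<open>On the edges at the component, sharing a centre in it is a relation of degree at most 2,
  so a path spans them. The edge \<open>g\<close> to a big vertex has a single centre in the
  component and is therefore an end of the path. Both directions are provided because the path may
  come before or after a tour of big vertices.\<close>

lemma small_comp_tour:
  assumes d: "d \<in> small G"
  assumes g: "g \<in> stars (small_comp G d)" "s \<in> big G" "g \<in> star s"
  obtains p where "tour (small_comp G d) p (stars (small_comp G d)) g"
    "tour (small_comp G d) g (stars (small_comp G d)) p"
proof -
  let ?C = "small_comp G d"
  define R where "R a b \<longleftrightarrow> a \<noteq> b \<and> (\<exists>x\<in>?C. a \<in> star x \<and> b \<in> star x)" for a b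
  have sC: "x \<in> small G" if "x \<in> ?C" for x
    using that component_subset[OF d] by blast
  have fin: "finite (stars ?C)"
    unfolding stars_def using finite_small_comp[OF multigraph_G d] finite_star by blast
  have sym: "symp R"
    by (auto simp: symp_def R_def)
  have conn: "conn_in (stars ?C) R a b" if ab: "a \<in> stars ?C" "b \<in> stars ?C" for a b
  proof -
    have link: "conn_in (stars ?C) R a b" if "x \<in> ?C" "a \<in> star x" "b \<in> star x" for a b x
      using that by (cases "a = b") (auto simp: R_def stars_def intro!: conn_in_step)
    obtain x y where xy: "x \<in> ?C" "a \<in> star x" "y \<in> ?C" "b \<in> star y"
      using ab by (auto simp: stars_def)
    from comp_conn[OF d xy(1,3)] xy(4) show ?thesis
    proof (induction arbitrary: b rule: conn_in_induct)
      case refl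
      then show ?case
        using link xy by blast
    next
      case (step y z)
      obtain h where "h \<in> verts H" "en h = {y, z}"
        using step adjacent_G by blast
      then have "h \<in> star y" "h \<in> star z"
        by (auto simp: star_def)
      then show ?case
        using step.IH[of h] link[of z h b] step conn_in_trans by metis
    qed
  qed
  have le1: "card (star x - {a}) \<le> 1" if "x \<in> ?C" "a \<in> star x" for x a
  proof -
    have "card (star x) \<le> 2"
      using sC[OF that(1)] by (auto simp: card_star small_def big_def)
    then show ?thesis
      using that(2) by (simp add: finite_star)
  qed
  have deg: "card {b \<in> stars ?C. R a b} \<le> 2 \<and>
      (\<forall>s\<in>big G. a \<in> star s \<longrightarrow> card {b \<in> stars ?C. R a b} \<le> 1)" if a: "a \<in> stars ?C" for a
  proof -
    obtain x where x: "x \<in> ?C" "a \<in> star x"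
      using a by (auto simp: stars_def)
    then obtain y where y: "en a = {x, y}"
      using en_other by (metis (no_types, lifting) mem_Collect_eq star_def)
    have ax: "z = x \<or> z = y" if "a \<in> star z" for z
      using that y by (auto simp: star_def)
    have aH: "a \<in> star y"
      using x y by (auto simp: star_def)
    show ?thesis
    proof (cases "y \<in> ?C")
      case True
      have "{b \<in> stars ?C. R a b} \<subseteq> (star x - {a}) \<union> (star y - {a})"
        using ax by (auto simp: R_def)
      then have "card {b \<in> stars ?C. R a b} \<le> card ((star x - {a}) \<union> (star y - {a}))"
        by (intro card_mono) (auto simp: finite_star)
      also have "\<dots> \<le> 1 + 1"
        using le1 x True aH by (intro order_trans[OF card_Un_le] add_mono) auto
      finally have "card {b \<in> stars ?C. R a b} \<le> 2"
        by simp
      moreover have False if "s \<in> big G" "a \<in> star s" for s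
        using ax[OF that(2)] that(1) x True sC small_not_big by metis
      ultimately show ?thesis
        by blast
    next
      case False
      have "{b \<in> stars ?C. R a b} \<subseteq> star x - {a}"
        using ax False by (auto simp: R_def)
      then have "card {b \<in> stars ?C. R a b} \<le> card (star x - {a})"
        by (intro card_mono) (auto simp: finite_star)
      then have "card {b \<in> stars ?C. R a b} \<le> 1"
        using le1[OF x] by linarith
      then show ?thesis
        by auto
    qed
  qed
  have irr: "\<not> R a a" for a
    by (simp add: R_def)
  have ne: "stars ?C \<noteq> {}"
    using g by blast
  obtain w where w: "distinct w" "set w = stars ?C" "w \<noteq> []" "successively R w"
    and ext: "\<And>a. a \<in> stars ?C \<Longrightarrow> card {b \<in> stars ?C. R a b} \<le> 1 \<Longrightarrow> a = hd w \<or> a = last w"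
    using spanning_path_if_degree_le_2[OF fin ne sym irr conn] deg by blast
  have suc: "successively (\<lambda>a b. \<exists>x\<in>?C. a \<in> star x \<and> b \<in> star x) w"
    using w(4) by (rule successively_mono) (auto simp: R_def)
  then have suc': "successively (\<lambda>a b. \<exists>x\<in>?C. a \<in> star x \<and> b \<in> star x) (rev w)"
    by (simp add: conj_commute)
  have t1: "tour ?C (hd w) (stars ?C) (last w)"
    using tour_path[OF w(1,3) suc] w(2) by simp
  have t2: "tour ?C (last w) (stars ?C) (hd w)"
    using tour_path[OF _ _ suc'] w by (simp add: hd_rev last_rev)
  have "g = hd w \<or> g = last w"
    using ext deg g by blast
  then show thesis
    using that t1 t2 by blast
qed

text \<open>
  Short components can be bypassed, so a union of components of both kinds that is left only
  through short components is everything.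
\<close>

lemma closed_separation:
  assumes T: "T \<subseteq> big G" "\<And>s. s \<in> T \<Longrightarrow> big_comp G s \<subseteq> T"
    and Z: "Z \<subseteq> small G" "\<And>z. z \<in> Z \<Longrightarrow> small_comp G z \<subseteq> Z"
    and ZT: "\<And>z s. z \<in> Z \<Longrightarrow> s \<in> big G \<Longrightarrow> adjacent G z s \<Longrightarrow> s \<in> T"
    and TZ: "\<And>s d. s \<in> T \<Longrightarrow> d \<in> small G \<Longrightarrow> adjacent G s d \<Longrightarrow> d \<in> Z \<or> short 0 G d"
    and ne: "x0 \<in> Z \<union> T"
  shows "big G \<subseteq> T" "d \<in> small G \<Longrightarrow> d \<in> Z \<or> short 0 G d"
proof -
  \<comment> \<open>\<open>Y\<close> adds the short components that lead back only to
    \<open>T\<close>. It is closed under adjacency and hence contains all vertices.\<close>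
  define Y where "Y = Z \<union> T \<union> {d \<in> small G. short 0 G d \<and> attachments G (small_comp G d) \<subseteq> T}"
  have x0: "x0 \<in> Y" "x0 \<in> verts G"
    using ne T(1) Z(1) big_subset[of G] small_subset[of G] by (auto simp: Y_def)
  have closed: "v \<in> Y" if u: "u \<in> Y" and uv: "adjacent G u v" for u v
  proof -
    have v: "v \<in> big G \<or> v \<in> small G"
      using adjacent_verts[OF multigraph_G uv] by (auto simp: small_def)
    consider "u \<in> Z" | "u \<in> T" | "u \<in> small G" "short 0 G u" "attachments G (small_comp G u) \<subseteq> T"
      using u by (auto simp: Y_def)
    then show ?thesis
    proof cases
      case 1
      then show ?thesis
        using v ZT[OF 1 _ uv] component_adj[where R = "adjacent G" and X = "small G", OF _ uv] Z
        by (auto simp: Y_def)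
    next
      case 2
      show ?thesis
        using v
      proof
        assume "v \<in> big G"
        then show ?thesis
          using component_adj[where R = "adjacent G" and X = "big G", OF _ uv] T 2 by (auto simp: Y_def)
      next
        assume vs: "v \<in> small G"
        show ?thesis
        proof (cases "v \<in> Z")
          case False
          then have sh: "short 0 G v"
            using TZ[OF 2 vs uv] by simp
          \<comment> \<open>For \<open>t = 0\<close> the first alternative of \<open>short\<close>
            needs an empty component. So all attachments of this component lie in the big component
            of \<open>u\<close>, which is inside \<open>T\<close>.\<close>
          have "card (small_comp G v) \<noteq> 0"
            using finite_small_comp[OF multigraph_G vs] component_refl[of v "small G" "adjacent G"]
            by (metis card_eq_0_iff empty_iff)
          moreover have "u \<in> attachments G (small_comp G v)"
            using 2 T(1) adjacent_sym[OF uv] by (auto simp: attachments_def)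
          ultimately have "attachments G (small_comp G v) \<subseteq> big_comp G u"
            using sh by (auto simp: short_def component_def)
          then show ?thesis
            using sh vs T(2)[OF 2] by (auto simp: Y_def)
        qed (simp add: Y_def)
      qed
    next
      case 3
      show ?thesis
        using v
      proof
        assume "v \<in> big G"
        then have "v \<in> attachments G (small_comp G u)"
          using uv component_refl[of u "small G" "adjacent G"] unfolding attachments_def by blast
        then show ?thesis
          using 3 by (auto simp: Y_def)
      next
        assume vs: "v \<in> small G"
        then have "v \<in> small_comp G u"
          using component_adj[where R = "adjacent G", OF 3(1) uv] by simp
        then show ?thesis
          using 3 vs short_small_comp[of v G u 0] comp_eq[of v "small G" G u] by (simp add: Y_def)
      qed
    qed
  qed
  have all: "v \<in> Y" if v: "v \<in> verts G" for v
  proof (rule ccontr)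
    assume "v \<notin> Y"
    then show False
      using conn_in_leaves[OF connected_mgraph_conn_in[OF connected_G x0(2) v] x0(1)] closed by metis
  qed
  show "big G \<subseteq> T"
  proof
    fix s assume s: "s \<in> big G"
    then have "s \<in> Y" "s \<notin> small G"
      using all big_subset[of G] small_not_big[of s G] by blast+
    then show "s \<in> T"
      using Z(1) by (auto simp: Y_def)
  qed
  show "d \<in> Z \<or> short 0 G d" if d: "d \<in> small G"
  proof -
    have "d \<in> Y" "d \<notin> big G"
      using all d small_subset[of G] small_not_big[of d G] by blast+
    then show ?thesis
      using T(1) by (auto simp: Y_def)
  qed
qed

text \<open>For \<open>Z\<close> among the small vertices, a common element is an edge joining
  \<open>Z\<close> to the component of \<open>s\<close>. It is the vertex of \<open>H\<close> at
  which tours of the two meet.\<close>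

definition touching :: "'v set \<Rightarrow> 'v set" where
  "touching Z = {s \<in> big G. stars (big_comp G s) \<inter> stars Z \<noteq> {}}"

lemma touching_closed:
  assumes "s \<in> touching Z"
  shows "big_comp G s \<subseteq> touching Z"
proof
  fix s' assume s': "s' \<in> big_comp G s"
  then have "s' \<in> big G"
    using assms component_subset[of s "big G" "adjacent G"] by (auto simp: touching_def)
  then show "s' \<in> touching Z"
    using assms comp_eq[OF s'] by (simp add: touching_def)
qed

lemma adjacent_touching: "z \<in> Z \<Longrightarrow> s \<in> big G \<Longrightarrow> adjacent G z s \<Longrightarrow> s \<in> touching Z"
  using stars_edge[OF adjacent_sym, of z s "big_comp G s" Z] component_refl by (auto simp: touching_def)

lemma star_nonempty:
  assumes "x \<in> big G"
  obtains a where "a \<in> star x"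
  using assms card_star[of x] by (force simp: big_def)

text \<open>At most two components are not short. One of them can be traversed before the tour of
  the big vertices and another one after it; the short ones are skipped.\<close>

lemma dominating_tour:
  assumes few: "few_long 0 G"
  obtains p q U Y where "tour Y p U q" "stars (big G) \<subseteq> U"
    "\<forall>d\<in>small G. short 0 G d \<or> star d \<subseteq> U"
proof -
  obtain s0 where s0: "s0 \<in> big G"
    using big_G by blast
  have end_tour: "\<exists>p. tour C p (stars C) g \<and> tour C g (stars C) p"
    if d: "d \<in> small G" "C = small_comp G d" and g: "g \<in> stars (big_comp G m)" and m: "m \<in> big G"
      and gC: "g \<in> stars C"
    for d C g m
  proof -
    obtain s where "s \<in> big_comp G m" "g \<in> star s"
      using g by (auto simp: stars_def)
    moreover from this have "s \<in> big G"
      using component_subset[OF m] by blast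
    ultimately show ?thesis
      using small_comp_tour[OF d(1)] d(2) gC by metis
  qed
  have Zs: "small_comp G z \<subseteq> small_comp G d" if "z \<in> small_comp G d" for z d
    using comp_eq[OF that] by simp
  have star_sub: "star x \<subseteq> stars C" if "x \<in> C" for x C
    using that by (auto simp: stars_def)
  consider (none) "\<And>d. d \<in> small G \<Longrightarrow> short 0 G d"
    | (one) c where "c \<in> small G" "\<And>d. d \<in> small G \<Longrightarrow> short 0 G d \<or> d \<in> small_comp G c"
    | (two) c1 c2 where "c1 \<in> small G" "\<not> short 0 G c1" "c2 \<in> small G" "\<not> short 0 G c2"
        "c2 \<notin> small_comp G c1"
        "\<And>d. d \<in> small G \<Longrightarrow> short 0 G d \<or> d \<in> small_comp G c1 \<or> d \<in> small_comp G c2"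
    using few unfolding few_long_def by metis
  then show thesis
  proof cases
    case none
    \<comment> \<open>All small components can be bypassed, so the big vertices form a single
      component.\<close>
    have "big G \<subseteq> big_comp G s0"
    proof (rule closed_separation(1)[of "big_comp G s0" "{}" s0])
      show "big_comp G s0 \<subseteq> big G"
        by (rule component_subset[OF s0])
      show "big_comp G s \<subseteq> big_comp G s0" if "s \<in> big_comp G s0" for s
        using comp_eq[OF that] by simp
    qed (simp_all add: none)
    moreover obtain a where "a \<in> star s0"
      using star_nonempty[OF s0] .
    moreover from this have "a \<in> stars (big_comp G s0)"
      using star_sub[of s0 "big_comp G s0"] by auto
    ultimately obtain U where U: "tour ({} \<union> {} \<union> big G) a U a" "{a} \<union> {a} \<union> stars (big G) \<subseteq> U"
      using tour_join[OF tour_refl tour_refl empty_subsetI empty_subsetI Int_empty_left s0, of a a]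
      by (metis subsetD)
    then show thesis
      using that[OF U(1)] none by simp
  next
    case (one c)
    let ?C = "small_comp G c"
    note C = component_subset[OF one(1), of "adjacent G"]
    \<comment> \<open>Every component of big vertices is joined to \<open>?C\<close> by an edge, at
      which its closed tour can be spliced in.\<close>
    have tb: "big G \<subseteq> touching ?C"
    proof (rule closed_separation(1)[of _ ?C c])
      show "s \<in> touching ?C \<Longrightarrow> big_comp G s \<subseteq> touching ?C" for s
        by (rule touching_closed)
      show "z \<in> ?C \<Longrightarrow> s \<in> big G \<Longrightarrow> adjacent G z s \<Longrightarrow> s \<in> touching ?C" for z s
        by (rule adjacent_touching)
    qed (use one C Zs in \<open>auto simp: touching_def\<close>)
    then obtain g where g: "g \<in> stars (big_comp G s0)" "g \<in> stars ?C"
      using s0 by (auto simp: touching_def)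
    then obtain p where p: "tour ?C p (stars ?C) g"
      using end_tour[OF one(1) refl _ s0] by blast
    obtain U where U: "tour (?C \<union> {} \<union> big G) p U g" "stars ?C \<union> {g} \<union> stars (big G) \<subseteq> U"
    proof (rule tour_join[OF p tour_refl C empty_subsetI Int_empty_right s0 g(1) g(1)])
      show "stars (big_comp G s) \<inter> (stars ?C \<union> {g}) \<noteq> {}" if "s \<in> big G" for s
        using tb that by (auto simp: touching_def)
    qed
    have "short 0 G d \<or> star d \<subseteq> U" if "d \<in> small G" for d
      using one(2)[OF that] star_sub[of d ?C] U(2) by blast
    then show thesis
      using that[OF U(1)] U(2) by simp
  next
    case (two c1 c2)
    let ?C1 = "small_comp G c1" and ?C2 = "small_comp G c2"
    note C1 = component_subset[OF two(1), of "adjacent G"]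
    note C2 = component_subset[OF two(3), of "adjacent G"]
    have stars_Un: "stars (?C1 \<union> ?C2) = stars ?C1 \<union> stars ?C2"
      by (auto simp: stars_def)
    have tb: "big G \<subseteq> touching (?C1 \<union> ?C2)"
    proof (rule closed_separation(1)[of _ "?C1 \<union> ?C2" c1])
      show "s \<in> touching (?C1 \<union> ?C2) \<Longrightarrow> big_comp G s \<subseteq> touching (?C1 \<union> ?C2)" for s
        by (rule touching_closed)
      show "z \<in> ?C1 \<union> ?C2 \<Longrightarrow> s \<in> big G \<Longrightarrow> adjacent G z s \<Longrightarrow> s \<in> touching (?C1 \<union> ?C2)" for z s
        by (rule adjacent_touching)
      show "z \<in> ?C1 \<union> ?C2 \<Longrightarrow> small_comp G z \<subseteq> ?C1 \<union> ?C2" for z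
        using Zs by blast
    qed (use two C1 C2 in \<open>auto simp: touching_def\<close>)
    \<comment> \<open>The two paths have to be linked by one component of big vertices joined to
      both. Without one, \<open>?C1\<close> and \<open>touching ?C1\<close> could be left only
      through short components, and \<open>closed_separation\<close> would make \<open>c2\<close>
      short or put it into \<open>?C1\<close>.\<close>
    have "\<exists>m. m \<in> touching ?C1 \<and> m \<in> touching ?C2"
    proof (rule ccontr)
      assume no: "\<not> ?thesis"
      have "c2 \<in> ?C1 \<or> short 0 G c2"
      proof (rule closed_separation(2)[of "touching ?C1" ?C1 c1])
        show "s \<in> touching ?C1 \<Longrightarrow> big_comp G s \<subseteq> touching ?C1" for s
          by (rule touching_closed)
        show "z \<in> ?C1 \<Longrightarrow> s \<in> big G \<Longrightarrow> adjacent G z s \<Longrightarrow> s \<in> touching ?C1" for z s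
          by (rule adjacent_touching)
        show "d \<in> ?C1 \<or> short 0 G d" if d: "s \<in> touching ?C1" "d \<in> small G" "adjacent G s d" for s d
        proof -
          have "s \<in> big G"
            using d by (simp add: touching_def)
          then have "d \<notin> ?C2"
            using no d adjacent_touching[of d ?C2 s] adjacent_sym[OF d(3)] by blast
          then show ?thesis
            using two(6)[OF d(2)] by blast
        qed
      qed (use two C1 Zs in \<open>auto simp: touching_def\<close>)
      then show False
        using two by blast
    qed
    then obtain m g1 g2 where m: "m \<in> big G"
      and g: "g1 \<in> stars (big_comp G m)" "g1 \<in> stars ?C1"
        "g2 \<in> stars (big_comp G m)" "g2 \<in> stars ?C2"
      by (auto simp: touching_def)
    obtain p where p: "tour ?C1 p (stars ?C1) g1"
      using end_tour[OF two(1) refl g(1) m g(2)] by blast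
    obtain q where q: "tour ?C2 g2 (stars ?C2) q"
      using end_tour[OF two(3) refl g(3) m g(4)] by blast
    have touch: "stars (big_comp G s) \<inter> (stars ?C1 \<union> stars ?C2) \<noteq> {}" if "s \<in> big G" for s
      using tb that stars_Un by (auto simp: touching_def)
    obtain U where U: "tour (?C1 \<union> ?C2 \<union> big G) p U q" "stars ?C1 \<union> stars ?C2 \<union> stars (big G) \<subseteq> U"
      using tour_join[OF p q C1 C2 comp_disjoint[OF two(5)] m g(1) g(3) touch] .
    have "short 0 G d \<or> star d \<subseteq> U" if "d \<in> small G" for d
      using two(6)[OF that] star_sub[of d ?C1] star_sub[of d ?C2] U(2) by blast
    then show thesis
      using that[OF U(1)] U(2) by simp
  qed
qed

text \<open>The dominating tour visits an end of every edge of \<open>H\<close>, so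
  \<open>dtrail_extend\<close> turns it into a list of all vertices of \<open>K\<close>.\<close>

lemma traceable_K:
  assumes few: "few_long 0 G"
  shows "traceable K"
proof -
  obtain p q U Y where t: "tour Y p U q" "stars (big G) \<subseteq> U"
    and long: "\<forall>d\<in>small G. short 0 G d \<or> star d \<subseteq> U"
    using dominating_tour[OF few] .
  have dom: "en2 c \<inter> U \<noteq> {}" if c: "c \<in> verts K" for c
  proof -
    obtain a b where ab: "en2 c = {a, b}" "a \<noteq> b" "adjacent H a b"
      using L2.en[OF c] L2.adjacent_G c by (metis card_2_iff)
    obtain x where x: "a \<in> star x" "b \<in> star x"
      using adjacent_H_star[OF ab(3)] .
    have "x \<in> verts G"
      using x en by (auto simp: star_def)
    then consider "x \<in> big G" | "x \<in> small G" "\<not> short 0 G x" | "x \<in> small G" "short 0 G x"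
      by (auto simp: small_def)
    then show ?thesis
    proof cases
      case 1
      then show ?thesis
        using t(2) x ab by (auto simp: stars_def)
    next
      case 2
      then show ?thesis
        using long x ab by blast
    next
      case 3
      obtain y where y: "en a = {x, y}" "y \<noteq> x" "y \<in> verts G" "adjacent G x y"
        using en_other x(1) by (auto simp: star_def)
      obtain z where z: "en b = {x, z}" "z \<noteq> x" "z \<in> verts G" "adjacent G x z"
        using en_other x(2) by (auto simp: star_def)
      have abH: "a \<in> verts H" "b \<in> verts H"
        using x by (auto simp: star_def)
      have yz: "y \<noteq> z"
        using inj_onD[OF inj_en _ abH] y z ab(2) by auto
      \<comment> \<open>Here \<open>x\<close> lies in a component of at most two vertices, which
        cannot contain all of \<open>x\<close>, \<open>y\<close> and \<open>z\<close>. So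
        \<open>a\<close> or \<open>b\<close> has a big end and is visited.\<close>
      have "y \<in> big G \<or> z \<in> big G"
      proof (rule ccontr)
        assume "\<not> ?thesis"
        then have "y \<in> small_comp G x" "z \<in> small_comp G x"
          using component_adj[where R = "adjacent G", OF 3(1)] y z by (auto simp: small_def)
        then have "3 \<le> card (small_comp G x)"
          using yz y z by (intro card_ge3I[of _ x y z] finite_small_comp[OF multigraph_G 3(1)]) auto
        then show False
          using 3(2) by (auto simp: short_def)
      qed
      then have "a \<in> stars (big G) \<or> b \<in> stars (big G)"
        using y z abH by (auto simp: stars_def star_def)
      then show ?thesis
        using t(2) ab by blast
    qed
  qed
  obtain l where l: "dtrail en2 p l U q" "distinct l" "set l \<subseteq> verts K"
    using t(1) by (auto simp: tour_def centered_def)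
  have "finite (verts K - set l)"
    using L2.multigraph_H by (simp add: multigraph_def)
  then obtain r where r: "dtrail en2 p r U q" "distinct r" "set r = set l \<union> (verts K - set l)"
    using dtrail_extend[OF l(1,2), of "verts K - set l"] dom by (metis Diff_disjoint DiffD1)
  have set_r: "set r = verts K"
    using r(3) l(3) by blast
  have "successively (\<lambda>c d. c \<noteq> d \<and> en2 c \<inter> en2 d \<noteq> {}) r"
    using dtrail_successively[OF r(1)] successively_if_distinct[OF r(2)] by blast
  then have suc: "successively (adjacent K) r"
    by (rule successively_mono) (use set_r L2.adjacent_H in auto)
  \<comment> \<open>Two edges at a big vertex are adjacent, so \<open>K\<close> has a vertex and the
    path is nonempty.\<close>
  obtain s0 where s0: "s0 \<in> big G"
    using big_G by blast
  then have "3 \<le> card (star s0)"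
    by (simp add: big_def card_star)
  then have "\<not> card (star s0) \<le> Suc 0"
    by simp
  then obtain a b where "a \<in> star s0" "b \<in> star s0" "a \<noteq> b"
    using card_le_Suc0_iff_eq[of "star s0"] by (auto simp: finite_star)
  then have "verts K \<noteq> {}"
    using edge_between[of a s0 b "{s0}"] by (auto simp: centered_def)
  then show ?thesis
    using r(2) set_r suc unfolding traceable_def hamiltonian_path_def by (intro exI[of _ r]) auto
qed

end

section \<open>Iterated line graphs\<close>

lemma verts_nat_copy: "verts (nat_copy G) = to_nat_on (verts G) ` verts G"
  and edges_nat_copy: "edges (nat_copy G) = to_nat_on (edges G) ` edges G"
  by (simp_all add: nat_copy_def relabel_def)

lemma multigraph_ends: "multigraph G \<Longrightarrow> e \<in> edges G \<Longrightarrow> ends G e \<subseteq> verts G \<and> card (ends G e) = 2"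
  by (simp add: multigraph_def)

lemma inj_to_nat_on_verts: "multigraph G \<Longrightarrow> inj_on (to_nat_on (verts G)) (verts G)"
  and inj_to_nat_on_edges: "multigraph G \<Longrightarrow> inj_on (to_nat_on (edges G)) (edges G)"
  using nat_copy_iso(1,2)[of G] by (auto simp: bij_betw_def)

lemma multigraph_nat_copy:
  assumes "multigraph G"
  shows "multigraph (nat_copy G)"
proof -
  have "to_nat_on (verts G) ` ends G e \<subseteq> to_nat_on (verts G) ` verts G \<and>
      card (to_nat_on (verts G) ` ends G e) = 2" if "e \<in> edges G" for e
    using multigraph_ends[OF assms that] inj_to_nat_on_verts[OF assms]
    by (auto simp: card_image inj_on_subset)
  then show ?thesis
    using assms nat_copy_iso(3)[OF assms]
    by (auto simp: multigraph_def verts_nat_copy edges_nat_copy)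
qed

lemma adjacent_nat_copy:
  assumes "multigraph G" "x \<in> verts G" "y \<in> verts G"
  shows "adjacent (nat_copy G) (to_nat_on (verts G) x) (to_nat_on (verts G) y) \<longleftrightarrow> adjacent G x y"
proof -
  let ?f = "to_nat_on (verts G)"
  have "?f ` ends G e = {?f x, ?f y} \<longleftrightarrow> ends G e = {x, y}" if "e \<in> edges G" for e
    using inj_on_image_eq_iff[OF inj_to_nat_on_verts[OF assms(1)], of "ends G e" "{x, y}"]
      multigraph_ends[OF assms(1) that] assms by simp
  then show ?thesis
    by (simp add: adjacent_def edges_nat_copy nat_copy_iso(3)[OF assms(1)])
qed

lemma degree_nat_copy:
  assumes "multigraph G" "x \<in> verts G"
  shows "degree (nat_copy G) (to_nat_on (verts G) x) = degree G x"
proof -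
  let ?f = "to_nat_on (verts G)" and ?g = "to_nat_on (edges G)"
  have "?f x \<in> ?f ` ends G e \<longleftrightarrow> x \<in> ends G e" if "e \<in> edges G" for e
    using inj_on_image_mem_iff[OF inj_to_nat_on_verts[OF assms(1)] assms(2)]
      multigraph_ends[OF assms(1) that] by blast
  then have "{n \<in> edges (nat_copy G). ?f x \<in> ends (nat_copy G) n} = ?g ` {e \<in> edges G. x \<in> ends G e}"
    using nat_copy_iso(3)[OF assms(1)] by (auto simp: edges_nat_copy)
  moreover have "inj_on ?g {e \<in> edges G. x \<in> ends G e}"
    using inj_to_nat_on_edges[OF assms(1)] by (rule inj_on_subset) auto
  ultimately show ?thesis
    by (simp add: degree_def card_image)
qed

lemma connected_nat_copy:
  assumes "multigraph G" "connected_mgraph G"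
  shows "connected_mgraph (nat_copy G)"
proof -
  let ?f = "to_nat_on (verts G)"
  have "(adjacent (nat_copy G))\<^sup>*\<^sup>* (?f x) (?f y)" if "(adjacent G)\<^sup>*\<^sup>* x y" for x y
    using that
  proof (induction rule: rtranclp_induct)
    case (step y z)
    then have "adjacent (nat_copy G) (?f y) (?f z)"
      using adjacent_verts[OF assms(1) step(2)] adjacent_nat_copy[OF assms(1)] by simp
    then show ?case
      using step by simp
  qed simp
  then show ?thesis
    using assms(2) by (auto simp: connected_mgraph_def verts_nat_copy)
qed

lemma card_small_nat_copy:
  assumes "multigraph G" "v \<in> verts G"
  shows "card (small (nat_copy G) - nbrs (nat_copy G) (to_nat_on (verts G) v)) =
    card (small G - nbrs G v)"
proof -
  let ?f = "to_nat_on (verts G)"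
  have "?f x \<in> small (nat_copy G) - nbrs (nat_copy G) (?f v) \<longleftrightarrow> x \<in> small G - nbrs G v"
    if "x \<in> verts G" for x
    using that assms by (simp add: small_def big_def nbrs_def degree_nat_copy adjacent_nat_copy verts_nat_copy)
  moreover have "small (nat_copy G) \<subseteq> ?f ` verts G" "small G \<subseteq> verts G"
    using small_subset[of "nat_copy G"] small_subset[of G] by (simp_all add: verts_nat_copy)
  ultimately have "small (nat_copy G) - nbrs (nat_copy G) (?f v) = ?f ` (small G - nbrs G v)"
    by blast
  moreover have "inj_on ?f (small G - nbrs G v)"
    using inj_to_nat_on_verts[OF assms(1)] by (rule inj_on_subset) (auto simp: small_def)
  ultimately show ?thesis
    by (simp add: card_image)
qed

section \<open>Line graphs and their copies\<close>

lemma multigraph_line_graph: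
  assumes "multigraph G"
  shows "multigraph (line_graph G)"
proof -
  have "edges (line_graph G) \<subseteq> Pow (edges G)"
    by (auto simp: line_graph_def)
  then have "finite (edges (line_graph G))"
    using assms by (meson finite_Pow_iff finite_subset multigraph_def)
  then show ?thesis
    using assms by (auto simp: multigraph_def line_graph_def)
qed

lemma adjacent_line_graph:
  "adjacent (line_graph G) e f \<longleftrightarrow>
    e \<in> edges G \<and> f \<in> edges G \<and> e \<noteq> f \<and> ends G e \<inter> ends G f \<noteq> {}"
  by (auto simp: adjacent_def line_graph_def doubleton_eq_iff)

lemma degree_line_graph: "degree (line_graph G) e = card {f. adjacent (line_graph G) e f}"
proof -
  have "{s \<in> edges (line_graph G). e \<in> ends (line_graph G) s} =
      (\<lambda>f. {e, f}) ` {f. adjacent (line_graph G) e f}"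
    unfolding adjacent_line_graph by (auto simp: line_graph_def)
  moreover have "inj_on (\<lambda>f. {e, f}) {f. adjacent (line_graph G) e f}"
    by (auto simp: inj_on_def doubleton_eq_iff)
  ultimately show ?thesis
    by (simp add: degree_def card_image)
qed

text \<open>Supplies \<open>en\<close> in \<open>line_graph_of\<close>: the number \<open>n\<close>
  is decoded to the edge of \<open>G\<close> that it stands for.\<close>

definition line_ends :: "('v, 'e) mgraph \<Rightarrow> nat \<Rightarrow> 'v set" where
  "line_ends G n = ends G (inv_into (edges G) (to_nat_on (edges G)) n)"

lemma line_ends_to_nat_on:
  "multigraph G \<Longrightarrow> e \<in> edges G \<Longrightarrow> line_ends G (to_nat_on (edges G) e) = ends G e"
  by (simp add: line_ends_def inv_into_f_f[OF inj_to_nat_on_edges])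

lemma verts_nat_copy_line_graph:
  "verts (nat_copy (line_graph G)) = to_nat_on (edges G) ` edges G"
  by (simp add: verts_nat_copy line_graph_def)

lemma line_graph_of_nat_copy:
  assumes mg: "multigraph G"
  shows "line_graph_of G (nat_copy (line_graph G)) (line_ends G)"
proof -
  let ?L = "line_graph G" and ?N = "nat_copy (line_graph G)" and ?g = "to_nat_on (edges G)"
  note mgL = multigraph_line_graph[OF mg]
  note mgN = multigraph_nat_copy[OF mgL]
  have vL: "verts ?L = edges G"
    by (simp add: line_graph_def)
  note vN = verts_nat_copy_line_graph[of G]
  note le = line_ends_to_nat_on[OF mg]
  have adj: "adjacent ?N (?g e) (?g f) \<longleftrightarrow> adjacent ?L e f" if "e \<in> edges G" "f \<in> edges G" for e f
    using adjacent_nat_copy[OF mgL] that by (simp add: vL)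
  show ?thesis
  proof
    show "multigraph G" "multigraph ?N"
      by fact+
    show "line_ends G a \<subseteq> verts G \<and> card (line_ends G a) = 2" if "a \<in> verts ?N" for a
      using that multigraph_ends[OF mg] le by (auto simp: vN)
    show "adjacent G x y \<longleftrightarrow> (\<exists>a\<in>verts ?N. line_ends G a = {x, y})" for x y
      using le by (auto simp: vN adjacent_def)
    show "degree G x = card {a \<in> verts ?N. x \<in> line_ends G a}" for x
    proof -
      have "{a \<in> verts ?N. x \<in> line_ends G a} = ?g ` {e \<in> edges G. x \<in> ends G e}"
        using le by (auto simp: vN)
      moreover have "inj_on ?g {e \<in> edges G. x \<in> ends G e}"
        using inj_to_nat_on_edges[OF mg] by (rule inj_on_subset) auto
      ultimately show ?thesis
        by (simp add: degree_def card_image)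
    qed
    show "adjacent ?N a b \<longleftrightarrow> a \<noteq> b \<and> line_ends G a \<inter> line_ends G b \<noteq> {}"
      if ab: "a \<in> verts ?N" "b \<in> verts ?N" for a b
    proof -
      obtain e f where ef: "e \<in> edges G" "f \<in> edges G" "a = ?g e" "b = ?g f"
        using ab by (auto simp: vN)
      have "?g e = ?g f \<longleftrightarrow> e = f"
        using inj_on_eq_iff[OF inj_to_nat_on_edges[OF mg]] ef by blast
      then show ?thesis
        using adj ef by (simp add: adjacent_line_graph le)
    qed
    show "degree ?N a = card {b. adjacent ?N a b}" if a: "a \<in> verts ?N" for a
    proof -
      obtain e where e: "e \<in> edges G" "a = ?g e"
        using a by (auto simp: vN)
      have "{b. adjacent ?N a b} = ?g ` {f. adjacent ?L e f}"
      proof (intro equalityI subsetI)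
        fix b assume b: "b \<in> {b. adjacent ?N a b}"
        then obtain f where "f \<in> edges G" "b = ?g f"
          using adjacent_verts[OF mgN, of a b] by (auto simp: vN)
        then show "b \<in> ?g ` {f. adjacent ?L e f}"
          using b e adj by blast
      next
        fix b assume "b \<in> ?g ` {f. adjacent ?L e f}"
        then show "b \<in> {b. adjacent ?N a b}"
          using e adj by (auto simp: adjacent_line_graph)
      qed
      moreover have "inj_on ?g {f. adjacent ?L e f}"
        using inj_to_nat_on_edges[OF mg] by (rule inj_on_subset) (auto simp: adjacent_line_graph)
      moreover have "degree ?N a = degree ?L e"
        using degree_nat_copy[OF mgL, of e] e by (simp add: vL)
      ultimately show ?thesis
        by (simp add: degree_line_graph card_image)
    qed
  qed
qed

lemma inj_on_line_ends:
  assumes "multigraph G" "inj_on (ends G) (edges G)"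
  shows "inj_on (line_ends G) (verts (nat_copy (line_graph G)))"
  using assms by (auto simp: inj_on_def verts_nat_copy_line_graph line_ends_to_nat_on)

text \<open>Line graphs are simple even if \<open>G\<close> is not, so \<open>inj_en\<close> is
  available from the first iterate on.\<close>

lemma inj_on_ends_nat_copy_line_graph:
  assumes "multigraph G"
  shows "inj_on (ends (nat_copy (line_graph G))) (edges (nat_copy (line_graph G)))"
proof -
  let ?L = "line_graph G"
  note mgL = multigraph_line_graph[OF assms]
  have "s = s'" if "s \<in> edges ?L" "s' \<in> edges ?L"
    "to_nat_on (verts ?L) ` ends ?L s = to_nat_on (verts ?L) ` ends ?L s'" for s s'
  proof -
    have "ends ?L s = ends ?L s'"
      using inj_on_image_eq_iff[OF inj_to_nat_on_verts[OF mgL], of "ends ?L s" "ends ?L s'"]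
        that multigraph_ends[OF mgL] by simp
    then show ?thesis
      by (simp add: line_graph_def)
  qed
  then show ?thesis
    by (auto simp: inj_on_def edges_nat_copy nat_copy_iso(3)[OF mgL])
qed

text \<open>All degrees are at most 2, so the longest path argument applies to the whole vertex
  set.\<close>

lemma traceable_if_big_empty:
  assumes mg: "multigraph G" and con: "connected_mgraph G" and "big G = {}"
  shows "traceable G"
proof -
  have sm: "small G = verts G"
    using assms(3) by (simp add: small_def)
  have conn: "conn_in (verts G) (adjacent G) x y" if "x \<in> verts G" "y \<in> verts G" for x y
  proof -
    have "(adjacent G)\<^sup>*\<^sup>* x y"
      using con that by (simp add: connected_mgraph_def)
    then show ?thesis
    proof (induction rule: rtranclp_induct)
      case (step y z)
      then show ?case
        using adjacent_verts[OF mg step(2)] conn_in_trans[OF step.IH conn_in_step] by simp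
    qed simp
  qed
  have deg: "card {y \<in> verts G. adjacent G x y} \<le> 2" if "x \<in> verts G" for x
  proof -
    have "{y \<in> verts G. adjacent G x y} = {y. adjacent G x y}"
      using adjacent_verts[OF mg] by blast
    then show ?thesis
      using small_card_nbrs[OF mg] that sm by simp
  qed
  have fin: "finite (verts G)" and ne: "verts G \<noteq> {}"
    using mg con by (simp_all add: multigraph_def connected_mgraph_def)
  obtain w where "distinct w" "set w = verts G" "w \<noteq> []" "successively (adjacent G) w"
    by (rule spanning_path_if_degree_le_2[OF fin ne symp_adjacent adjacent_irrefl[OF mg] conn deg])
  then show ?thesis
    by (auto simp: traceable_def hamiltonian_path_def)
qed

text \<open>An iterate without big vertices is traceable. If there is none up to
  \<open>t + 3\<close>, every step meets the assumptions of the locales and lowers the bound in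
  \<open>few_long\<close> by one. The bound is 0 at iterate \<open>t + 1\<close>, and two further
  steps give a traceable graph.\<close>

lemma traceable_iterated_line_graph:
  assumes mg: "multigraph G" and con: "connected_mgraph G"
    and few: "few_long (Suc t) (nat_copy G)"
  shows "\<exists>i\<le>t + 3. traceable (iterated_line_graph i G)"
proof (rule ccontr)
  let ?I = "\<lambda>i. iterated_line_graph i G"
  note step = iterated_line_graph.simps(2)
  note [simp del] = step
  assume no: "\<not> (\<exists>i\<le>t + 3. traceable (?I i))"
  have big: "big (?I i) \<noteq> {}" if "i \<le> t + 3" "multigraph (?I i)" "connected_mgraph (?I i)" for i
    using no traceable_if_big_empty that by blast
  have inv: "multigraph (?I j) \<and> connected_mgraph (?I j) \<and> (j \<le> Suc t \<longrightarrow> few_long (Suc t - j) (?I j)) \<and>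
      (0 < j \<longrightarrow> inj_on (ends (?I j)) (edges (?I j)))" if "j \<le> t + 3" for j
    using that
  proof (induction j)
    case 0
    then show ?case
      using multigraph_nat_copy[OF mg] connected_nat_copy[OF mg con] few by simp
  next
    case (Suc j)
    then have IH: "multigraph (?I j)" "connected_mgraph (?I j)"
        "j \<le> Suc t \<longrightarrow> few_long (Suc t - j) (?I j)" and j: "j \<le> t + 3"
      by simp_all
    interpret line_graph_of "?I j" "?I (Suc j)" "line_ends (?I j)"
      unfolding step by (rule line_graph_of_nat_copy[OF IH(1)])
    obtain x where "x \<in> big (?I j)"
      using big[OF j IH(1,2)] by blast
    then have "verts (?I (Suc j)) \<noteq> {}"
      by (rule verts_H_nonempty)
    then have con': "connected_mgraph (?I (Suc j))"
      using connected_H[OF IH(2)] by blast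
    have "few_long (Suc t - Suc j) (?I (Suc j))" if "Suc j \<le> Suc t"
    proof -
      interpret connected_line_graph_of "?I j" "?I (Suc j)" "line_ends (?I j)"
        by unfold_locales (use IH(2) big[OF j IH(1,2)] big[OF Suc.prems multigraph_H con'] in auto)
      show ?thesis
        using few_long_H[of "t - j"] IH(3) that by (simp add: Suc_diff_le)
    qed
    then show ?case
      using multigraph_H con' inj_on_ends_nat_copy_line_graph[OF IH(1)] by (simp flip: step)
  qed
  \<comment> \<open>At this iterate the bound is 0, and since at least one step has been made, the
    graph is simple, as \<open>inj_en\<close> demands.\<close>
  let ?j = "Suc t"
  have J: "multigraph (?I ?j)" "connected_mgraph (?I ?j)" "few_long 0 (?I ?j)"
      "inj_on (ends (?I ?j)) (edges (?I ?j))"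
    using inv[of ?j] by simp_all
  have J1: "multigraph (?I (Suc ?j))" "connected_mgraph (?I (Suc ?j))"
    using inv[of "Suc ?j"] by simp_all
  interpret A: line_graph_of "?I ?j" "?I (Suc ?j)" "line_ends (?I ?j)"
    unfolding step[of ?j] by (rule line_graph_of_nat_copy[OF J(1)])
  interpret B: line_graph_of "?I (Suc ?j)" "?I (Suc (Suc ?j))" "line_ends (?I (Suc ?j))"
    unfolding step[of "Suc ?j"] by (rule line_graph_of_nat_copy[OF J1(1)])
  interpret double_line_graph_of "?I ?j" "?I (Suc ?j)" "line_ends (?I ?j)" "?I (Suc (Suc ?j))"
    "line_ends (?I (Suc ?j))"
  proof unfold_locales
    show "connected_mgraph (?I ?j)"
      by (rule J)
    show "big (?I ?j) \<noteq> {}"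
      using big[OF _ J(1,2)] by simp
    show "big (?I (Suc ?j)) \<noteq> {}"
      using big[OF _ J1] by simp
    show "inj_on (line_ends (?I ?j)) (verts (?I (Suc ?j)))"
      unfolding step[of ?j] by (rule inj_on_line_ends[OF J(1,4)])
  qed
  have "traceable (?I (t + 3))"
    using traceable_K[OF J(3)] by (simp add: eval_nat_numeral)
  then show False
    using no by blast
qed

lemma Union_verts_of_degree:
  assumes "multigraph G"
  shows "(\<Union>i\<in>{3..max_degree G}. verts_of_degree G i) = big G"
proof -
  have "degree G v \<le> max_degree G" if "v \<in> verts G" for v
    using assms that by (simp add: max_degree_def multigraph_def)
  then show ?thesis
    by (auto simp: verts_of_degree_def big_def)
qed

theorem theorem18:
  fixes G :: "('v, 'e) mgraph" and n :: nat
  assumes "multigraph G"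
    and "connected_mgraph G"
    and "card (verts G) = n"
  shows "(\<exists>m. traceable (iterated_line_graph m G)) \<and>
         int (hamiltonian_path_index G)
           \<le> \<lfloor>(real n - real (max_nbrs G) - real (d_ge3 G)) / 3\<rfloor> + 3"
proof -
  have fin: "finite (verts G)" and ne: "verts G \<noteq> {}"
    using assms by (simp_all add: multigraph_def connected_mgraph_def)
  have mx: "max_nbrs G \<in> (\<lambda>v. card (nbrs G v)) ` verts G"
    unfolding max_nbrs_def using fin ne by (intro Max_in) auto
  let ?D = "{card (big G - nbrs G v) |v. v \<in> verts G \<and> card (nbrs G v) = max_nbrs G}"
  have "?D \<noteq> {}"
    using mx by auto
  moreover have "finite ?D"
    using fin by simp
  ultimately have "d_ge3 G \<in> ?D"
    unfolding d_ge3_def Union_verts_of_degree[OF assms(1)] by (intro Max_in)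
  then obtain v where v: "v \<in> verts G" "card (nbrs G v) = max_nbrs G" "card (big G - nbrs G v) = d_ge3 G"
    by auto
  define k where "k = card (small G - nbrs G v)"
  \<comment> \<open>By the choice of \<open>v\<close> the first two parts have
    \<open>max_nbrs G\<close> and \<open>d_ge3 G\<close> elements, so the numerator of the bound is
    exactly \<open>k\<close>.\<close>
  have "verts G = nbrs G v \<union> ((big G - nbrs G v) \<union> (small G - nbrs G v))"
    by (auto simp: nbrs_def small_def big_def)
  also have "card \<dots> = card (nbrs G v) + (card (big G - nbrs G v) + card (small G - nbrs G v))"
    using fin by (subst card_Un_disjoint card_Un_disjoint; auto simp: nbrs_def small_def big_def)+
  finally have n: "n = max_nbrs G + d_ge3 G + k"
    using assms(3) v by (simp add: k_def)
  have "few_long (Suc (k div 3)) (nat_copy G)"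
  proof (rule few_long_if_card_less[OF multigraph_nat_copy[OF assms(1)]])
    show "to_nat_on (verts G) v \<in> verts (nat_copy G)"
      using v by (simp add: verts_nat_copy)
    show "card (small (nat_copy G) - nbrs (nat_copy G) (to_nat_on (verts G) v)) < 3 * Suc (k div 3)"
      unfolding card_small_nat_copy[OF assms(1) v(1)] k_def[symmetric] by presburger
  qed
  then obtain i where i: "i \<le> k div 3 + 3" "traceable (iterated_line_graph i G)"
    using traceable_iterated_line_graph[OF assms(1,2)] by blast
  then have "hamiltonian_path_index G \<le> k div 3 + 3"
    unfolding hamiltonian_path_index_def by (meson Least_le order_trans)
  moreover have "\<lfloor>(real n - real (max_nbrs G) - real (d_ge3 G)) / 3\<rfloor> = int (k div 3)"
    using floor_divide_of_nat_eq[of k 3, where 'a = real] by (simp add: n)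
  ultimately show ?thesis
    using i by auto
qed

end
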